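(* Let $d\ge 1$ and let $\mathcal T$ be the Terwilliger algebra of $H^*(d,3)$ with respect to the base vertex $(0,\dots,0)$. Under the identification $\mathrm{Mat}_X(\mathbb C)\cong \mathrm{Mat}_3(\mathbb C)^{\otimes d}$ described below, $\mathcal T=\mathrm{Sym}^{(d)}(\mathrm{Mat}_3(\mathbb C))$; in particular $\mathcal T\simeq \mathrm{Sym}^{(d)}(\mathrm{Mat}_3(\mathbb C))$. Moreover $$\mathcal T\simeq \mathrm{Sym}^{(d)}(\mathrm{Mat}_3(\mathbb C))\simeq \bigoplus_{(\ell,m)}\mathrm{Mat}_{n_{\ell,m}}(\mathbb C),$$ where the direct sum runs over all pairs of integers $(\ell,m)$ with $0\le \ell\le \lfloor d/3\rfloor$ and $0\le m\le \lfloor (d-3\ell)/2\rfloor$, and $$n_{\ell,m}=\tfrac12\,(d-3\ell-2m+1)(m+1)(d-3\ell-m+2).$$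
   Context: Let $\mathbb F_3=\{0,1,2\}$ (integers mod 3) and $X=\mathbb F_3^d$. The Hamming digraph $H^*(d,3)$ has vertex set $X$, with an arc from $y$ to $z$ iff $y$ and $z$ differ in exactly one coordinate $i$ and $z_i=y_i+1$ in $\mathbb F_3$. Let $V=\mathbb C^X$ with standard basis $\{\hat y: y\in X\}$, and $\mathrm{Mat}_X(\mathbb C)$ the algebra of complex matrices with rows and columns indexed by $X$. The adjacency matrix $A$ has $(y,z)$-entry $1$ if there is an arc from $y$ to $z$ and $0$ otherwise; $A^\top$ is its transpose. For integers $s,t$, $E^*_{[s,t]}\in \mathrm{Mat}_X(\mathbb C)$ is the diagonal matrix whose $(y,y)$-entry is $1$ if $y$ has exactly $s$ coordinates equal to $1$ and $t$ coordinates equal to $2$, and $0$ otherwise. The Terwilliger algebra $\mathcal T$ is the subalgebra of $\mathrm{Mat}_X(\mathbb C)$ generated by $A$, $A^\top$ and all $E^*_{[s,t]}$. Let $e_0,e_1,e_2$ be the standard basis of $\mathbb C^3$; identify $V$ with $(\mathbb C^3)^{\otimes d}$ via $\hat y\mapsto e_{y_1}\otimes\cdots\otimes e_{y_d}$, which identifies $\mathrm{Mat}_X(\mathbb C)$ with $\mathrm{Mat}_3(\mathbb C)^{\otimes d}$. $\mathrm{Sym}^{(d)}(\mathrm{Mat}_3(\mathbb C))$ denotes the subalgebra of $\mathrm{Mat}_3(\mathbb C)^{\otimes d}$ consisting of the tensors invariant under every permutation of the $d$ tensor factors. *)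

theory Defs
  imports Complex_Main "HOL-Combinatorics.Permutations"
begin

text \<open>Vertices of H*(d,3): words of length d over F_3 = {0,1,2} (as naturals).
Matrices indexed by X are functions nat list => nat list => complex that vanish
outside X x X.\<close>

type_synonym xmat = "nat list \<Rightarrow> nat list \<Rightarrow> complex"

definition Xset :: "nat \<Rightarrow> nat list set" where
  "Xset d = {ys. length ys = d \<and> set ys \<subseteq> {0,1,2}}"

definition arc :: "nat \<Rightarrow> nat list \<Rightarrow> nat list \<Rightarrow> bool" where
  "arc d y z \<longleftrightarrow> y \<in> Xset d \<and> z \<in> Xset d \<and>
     (\<exists>i<d. z ! i = (y ! i + 1) mod 3 \<and> (\<forall>j<d. j \<noteq> i \<longrightarrow> y ! j = z ! j))"

definition adjA :: "nat \<Rightarrow> xmat" where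
  "adjA d = (\<lambda>y z. if arc d y z then 1 else 0)"

definition adjAT :: "nat \<Rightarrow> xmat" where
  "adjAT d = (\<lambda>y z. adjA d z y)"

definition cnt :: "nat \<Rightarrow> nat list \<Rightarrow> nat" where
  "cnt a y = length (filter (\<lambda>x. x = a) y)"

definition Estar :: "nat \<Rightarrow> int \<Rightarrow> int \<Rightarrow> xmat" where
  "Estar d s t = (\<lambda>y z. if y = z \<and> y \<in> Xset d \<and> int (cnt 1 y) = s \<and> int (cnt 2 y) = t
                        then 1 else 0)"

definition xone :: "nat \<Rightarrow> xmat" where
  "xone d = (\<lambda>y z. if y = z \<and> y \<in> Xset d then 1 else 0)"

definition xadd :: "xmat \<Rightarrow> xmat \<Rightarrow> xmat" where
  "xadd M N = (\<lambda>y z. M y z + N y z)"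

definition xscale :: "complex \<Rightarrow> xmat \<Rightarrow> xmat" where
  "xscale c M = (\<lambda>y z. c * M y z)"

definition xmul :: "nat \<Rightarrow> xmat \<Rightarrow> xmat \<Rightarrow> xmat" where
  "xmul d M N = (\<lambda>y z. \<Sum>w\<in>Xset d. M y w * N w z)"

inductive_set Terwilliger :: "nat \<Rightarrow> xmat set" for d :: nat where
  gen_A: "adjA d \<in> Terwilliger d"
| gen_AT: "adjAT d \<in> Terwilliger d"
| gen_E: "Estar d s t \<in> Terwilliger d"
| one: "xone d \<in> Terwilliger d"
| add: "M \<in> Terwilliger d \<Longrightarrow> N \<in> Terwilliger d \<Longrightarrow> xadd M N \<in> Terwilliger d"
| scale: "M \<in> Terwilliger d \<Longrightarrow> xscale c M \<in> Terwilliger d"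
| mul: "M \<in> Terwilliger d \<Longrightarrow> N \<in> Terwilliger d \<Longrightarrow> xmul d M N \<in> Terwilliger d"

definition permw :: "nat \<Rightarrow> (nat \<Rightarrow> nat) \<Rightarrow> nat list \<Rightarrow> nat list" where
  "permw d \<sigma> y = map (\<lambda>i. y ! \<sigma> i) [0..<d]"

text \<open>Sym^(d)(Mat_3(C)) under the identification Mat_X(C) = Mat_3(C)^{\<otimes> d}:
the matrices on X invariant under simultaneously permuting the coordinates
of row and column index.\<close>

definition SymMat :: "nat \<Rightarrow> xmat set" where
  "SymMat d = {M. (\<forall>y z. (y \<notin> Xset d \<or> z \<notin> Xset d) \<longrightarrow> M y z = 0) \<and>
     (\<forall>\<sigma>. \<sigma> permutes {0..<d} \<longrightarrow>
        (\<forall>y\<in>Xset d. \<forall>z\<in>Xset d. M (permw d \<sigma> y) (permw d \<sigma> z) = M y z))}"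

definition blocks :: "nat \<Rightarrow> (nat \<times> nat) set" where
  "blocks d = {(l, m). l \<le> d div 3 \<and> m \<le> (d - 3 * l) div 2}"

definition nsize :: "nat \<Rightarrow> nat \<times> nat \<Rightarrow> nat" where
  "nsize d p = (case p of (l, m) \<Rightarrow>
     ((d - 3*l - 2*m + 1) * (m + 1) * (d - 3*l - m + 2)) div 2)"

type_synonym bmat = "nat \<times> nat \<Rightarrow> nat \<Rightarrow> nat \<Rightarrow> complex"

definition DSum :: "nat \<Rightarrow> bmat set" where
  "DSum d = {f. \<forall>p i j. f p i j \<noteq> 0 \<longrightarrow> p \<in> blocks d \<and> i < nsize d p \<and> j < nsize d p}"

definition badd :: "bmat \<Rightarrow> bmat \<Rightarrow> bmat" where
  "badd f g = (\<lambda>p i j. f p i j + g p i j)"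

definition bscale :: "complex \<Rightarrow> bmat \<Rightarrow> bmat" where
  "bscale c f = (\<lambda>p i j. c * f p i j)"

definition bmul :: "nat \<Rightarrow> bmat \<Rightarrow> bmat \<Rightarrow> bmat" where
  "bmul d f g = (\<lambda>p i j. \<Sum>k<nsize d p. f p i k * g p k j)"

definition alg_iso_dsum :: "nat \<Rightarrow> xmat set \<Rightarrow> (xmat \<Rightarrow> bmat) \<Rightarrow> bool" where
  "alg_iso_dsum d S \<phi> \<longleftrightarrow> bij_betw \<phi> S (DSum d) \<and>
     (\<forall>M\<in>S. \<forall>N\<in>S. \<phi> (xadd M N) = badd (\<phi> M) (\<phi> N)) \<and>
     (\<forall>c. \<forall>M\<in>S. \<phi> (xscale c M) = bscale c (\<phi> M)) \<and>
     (\<forall>M\<in>S. \<forall>N\<in>S. \<phi> (xmul d M N) = bmul d (\<phi> M) (\<phi> N))"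

end

theory Submission
  imports Defs
begin

text \<open>
  A symmetric matrix is constant on the orbits of pairs of words, and an orbit is the multiset of the
  pairs of letters occurring. Multiplying an orbit matrix by the operator that changes one letter
  produces one orbit with more off-diagonal pairs, so the one-letter operators and the diagonal
  matrices generate all symmetric matrices; they lie in the Terwilliger algebra because \<open>E\<^sup>*\<close> separates
  the three kinds of arcs. Sorting such products with lowering operators on the left and raising
  operators on the right shows that a symmetric matrix acts between highest weight vectors as a
  scalar. For each block \<open>(l, m)\<close> the tensor product of exterior powers
  \<open>e\<^sub>0\<close> (\<open>d - 3l - 2m\<close> times), \<open>e\<^sub>0 \<and> e\<^sub>1\<close> (\<open>m\<close> times) and \<open>e\<^sub>0 \<and> e\<^sub>1 \<and> e\<^sub>2\<close> (\<open>l\<close> times) is a highest weight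
  vector \<open>v\<close>; averaging the projector onto \<open>v\<close> over the symmetric group gives a symmetric matrix of
  rank one on the module generated by \<open>v\<close> and zero on the other modules, hence all matrix units.
  Coordinates of translates of \<open>v\<close> under lower unipotent matrices bound the dimension of the module
  from below by \<open>n\<^bsub>l,m\<^esub>\<close>, while the sum of the \<open>n\<^bsub>l,m\<^esub>\<^sup>2\<close> equals \<open>(d + 8) choose 8\<close>, the number of orbits;
  both bounds are therefore equalities.
\<close>

section \<open>Linear algebra\<close>

text \<open>A homogeneous linear system with more unknowns than equations has a nontrivial solution.
  Gaussian elimination, by induction on the equations: an equation with a nonzero coefficient at
  \<open>i0\<close> eliminates the unknown \<open>i0\<close> from the others.\<close>

lemma linear_dependence:
  fixes a :: "'i \<Rightarrow> 'j \<Rightarrow> 'k::field"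
  assumes "finite J" and "finite I" and "card J < card I"
  shows "\<exists>c. (\<exists>i\<in>I. c i \<noteq> 0) \<and> (\<forall>j\<in>J. (\<Sum>i\<in>I. c i * a i j) = 0)"
  using assms
proof (induction J arbitrary: I a rule: finite_induct)
  case empty
  then have "I \<noteq> {}" by auto
  then show ?case by (intro exI[of _ "\<lambda>_. 1"]) auto
next
  case (insert j J)
  show ?case
  proof (cases "\<forall>i\<in>I. a i j = 0")
    case True
    have "card J < card I" using insert by auto
    then obtain c where "\<exists>i\<in>I. c i \<noteq> 0" "\<forall>k\<in>J. (\<Sum>i\<in>I. c i * a i k) = 0"
      using insert.IH[OF insert.prems(1)] by blast
    then show ?thesis using True by (intro exI[of _ c]) auto
  next
    case False
    then obtain i0 where i0: "i0 \<in> I" "a i0 j \<noteq> 0" by auto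
    define I' where "I' = I - {i0}"
    have I: "I = insert i0 I'" "i0 \<notin> I'" "finite I'"
      using i0 insert.prems by (auto simp: I'_def)
    have "card J < card I'" using insert I by auto
    then obtain c where c: "\<exists>i\<in>I'. c i \<noteq> 0"
      "\<forall>k\<in>J. (\<Sum>i\<in>I'. c i * (a i k - a i j / a i0 j * a i0 k)) = 0"
      using insert.IH[OF I(3), of "\<lambda>i k. a i k - a i j / a i0 j * a i0 k"] by blast
    \<comment> \<open>The eliminated unknown gets back the value that makes equation
      \<open>j\<close> true.\<close>
    define e where "e = (\<lambda>i. if i = i0 then - (\<Sum>i\<in>I'. c i * a i j / a i0 j) else c i)"
    have e: "(\<Sum>i\<in>I. e i * f i) = - (\<Sum>i\<in>I'. c i * a i j / a i0 j) * f i0 + (\<Sum>i\<in>I'. c i * f i)" for f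
    proof -
      have "(\<Sum>i\<in>I'. e i * f i) = (\<Sum>i\<in>I'. c i * f i)"
        using I by (intro sum.cong) (auto simp: e_def)
      then show ?thesis using I by (simp add: e_def)
    qed
    have "(\<Sum>i\<in>I. e i * a i k) = 0" if "k \<in> insert j J" for k
    proof (cases "k = j")
      case True
      have "(\<Sum>i\<in>I'. c i * a i j / a i0 j) * a i0 j = (\<Sum>i\<in>I'. c i * a i j)"
        using i0 by (simp add: sum_distrib_right)
      then show ?thesis using True by (simp add: e)
    next
      case False
      then have "(\<Sum>i\<in>I'. c i * (a i k - a i j / a i0 j * a i0 k)) = 0" using c that by auto
      moreover have "(\<Sum>i\<in>I'. c i * (a i k - a i j / a i0 j * a i0 k))
          = (\<Sum>i\<in>I'. c i * a i k) - (\<Sum>i\<in>I'. c i * a i j / a i0 j) * a i0 k"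
        by (simp add: right_diff_distrib sum_subtractf sum_distrib_right mult.assoc)
      ultimately show ?thesis by (simp add: e)
    qed
    moreover have "\<exists>i\<in>I. e i \<noteq> 0" using c(1) I by (auto simp: e_def)
    ultimately show ?thesis by blast
  qed
qed

section \<open>Hermitian form and orthonormal bases\<close>

definition cip :: "'a set \<Rightarrow> ('a \<Rightarrow> complex) \<Rightarrow> ('a \<Rightarrow> complex) \<Rightarrow> complex" where
  "cip X v w = (\<Sum>x\<in>X. cnj (v x) * w x)"

lemma cip_add_right: "cip X v (\<lambda>x. w x + w' x) = cip X v w + cip X v w'"
  by (simp add: cip_def algebra_simps sum.distrib)

lemma cip_diff_right: "cip X v (\<lambda>x. w x - w' x) = cip X v w - cip X v w'"
  by (simp add: cip_def algebra_simps sum_subtractf)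

lemma cip_scale_right: "cip X v (\<lambda>x. c * w x) = c * cip X v w"
  by (simp add: cip_def algebra_simps sum_distrib_left)

lemma cip_scale_left: "cip X (\<lambda>x. c * w x) v = cnj c * cip X w v"
  by (simp add: cip_def algebra_simps sum_distrib_left)

lemma cip_sum_right: "cip X v (\<lambda>x. \<Sum>i\<in>I. f i x) = (\<Sum>i\<in>I. cip X v (f i))"
  by (simp add: cip_def sum_distrib_left sum.swap[of _ I])

lemma cip_commute: "cip X v w = cnj (cip X w v)"
  by (simp add: cip_def mult.commute)

lemma cip_self: "cip X v v = of_real (\<Sum>x\<in>X. (cmod (v x))\<^sup>2)"
  by (simp add: cip_def complex_norm_square[symmetric] mult.commute del: of_real_power)

lemma cip_self_eq_0:
  assumes "finite X" and "cip X v v = 0" and "x \<in> X"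
  shows "v x = 0"
proof -
  have "(\<Sum>x\<in>X. (cmod (v x))\<^sup>2) = 0"
    using assms(2) unfolding cip_self of_real_eq_0_iff .
  then show ?thesis using assms by (simp add: sum_nonneg_eq_0_iff)
qed

text \<open>An orthonormal system of maximal length exists because such systems are linearly
  independent, hence no longer than \<open>card X\<close>. If some \<open>w\<close> were not
  reproduced by its coefficients, its normalised residual would extend the system.\<close>

lemma orthonormal_basis_exists:
  fixes W :: "('a \<Rightarrow> complex) set"
  assumes fin: "finite X"
    and supp: "\<And>w x. w \<in> W \<Longrightarrow> x \<notin> X \<Longrightarrow> w x = 0"
    and add: "\<And>v w. v \<in> W \<Longrightarrow> w \<in> W \<Longrightarrow> (\<lambda>x. v x + w x) \<in> W"
    and scale: "\<And>c w. w \<in> W \<Longrightarrow> (\<lambda>x. c * w x) \<in> W"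
  shows "\<exists>(n::nat) u. (\<forall>i<n. u i \<in> W) \<and> (\<forall>i<n. \<forall>j<n. cip X (u i) (u j) = of_bool (i = j)) \<and>
    (\<forall>w\<in>W. \<forall>x. w x = (\<Sum>i<n. cip X (u i) w * u i x))"
proof -
  define P where "P = (\<lambda>(n::nat) u. (\<forall>i<n. u i \<in> W) \<and>
    (\<forall>i<n. \<forall>j<n. cip X (u i) (u j) = of_bool (i = j)))"
  have bound: "n \<le> card X" if "P n u" for n u
  proof (rule ccontr)
    assume "\<not> n \<le> card X"
    then have "card X < card {..<n}" by simp
    from linear_dependence[OF fin finite_lessThan this, of u]
    obtain c j where c: "j < n" "c j \<noteq> 0" "\<forall>x\<in>X. (\<Sum>i<n. c i * u i x) = 0" by auto
    have "0 = cip X (u j) (\<lambda>x. \<Sum>i<n. c i * u i x)" using c(3) by (simp add: cip_def)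
    also have "\<dots> = (\<Sum>i<n. c i * cip X (u j) (u i))" by (simp add: cip_sum_right cip_scale_right)
    also have "\<dots> = (\<Sum>i<n. if j = i then c i else 0)"
      using that c(1) by (intro sum.cong) (auto simp: P_def)
    also have "\<dots> = c j" using c(1) by simp
    finally show False using c(2) by simp
  qed
  have "\<exists>u. P 0 u" by (simp add: P_def)
  then obtain n where n: "\<exists>u. P n u" "\<forall>k. (\<exists>u. P k u) \<longrightarrow> k \<le> n"
    using Nat.ex_has_greatest_nat[of "\<lambda>n. \<exists>u. P n u" 0 "card X"] bound by blast
  then obtain u where u: "P n u" by blast
  have "w x = (\<Sum>i<n. cip X (u i) w * u i x)" if w: "w \<in> W" for w x
  proof (rule ccontr)
    assume neq: "w x \<noteq> (\<Sum>i<n. cip X (u i) w * u i x)"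
    have comb: "(\<lambda>x. \<Sum>i<k. c i * u i x) \<in> W" if "k \<le> n" for c k
      using that
    proof (induction k)
      case 0
      then show ?case using scale[OF w, of 0] by simp
    next
      case (Suc k)
      then show ?case using u add[OF _ scale[of "u k" "c k"]] by (simp add: P_def)
    qed
    define r where "r = (\<lambda>x. w x - (\<Sum>i<n. cip X (u i) w * u i x))"
    have rW: "r \<in> W"
      using add[OF w scale[OF comb[OF order_refl, of "\<lambda>i. cip X (u i) w"], of "-1"]]
      by (simp add: r_def)
    have rx: "r x \<noteq> 0" using neq by (simp add: r_def)
    then have "x \<in> X" using supp[OF rW] by blast
    then have rr: "cip X r r \<noteq> 0" using cip_self_eq_0[OF fin] rx by blast
    have orth: "cip X (u j) r = 0" if "j < n" for j
    proof -
      have "cip X (u j) r = cip X (u j) w - (\<Sum>i<n. cip X (u i) w * cip X (u j) (u i))"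
        unfolding r_def by (simp add: cip_diff_right cip_sum_right cip_scale_right)
      also have "(\<Sum>i<n. cip X (u i) w * cip X (u j) (u i)) = (\<Sum>i<n. if j = i then cip X (u i) w else 0)"
        using u that by (intro sum.cong) (auto simp: P_def)
      also have "\<dots> = cip X (u j) w" using that by simp
      finally show ?thesis by simp
    qed
    define q where "q = (\<Sum>x\<in>X. (cmod (r x))\<^sup>2)"
    have q: "q > 0" "cip X r r = of_real q"
    proof -
      have "q \<ge> 0" unfolding q_def by (intro sum_nonneg) auto
      moreover show "cip X r r = of_real q" by (simp only: cip_self q_def)
      ultimately show "q > 0" using rr by (cases "q = 0") auto
    qed
    \<comment> \<open>The normalising factor is real, so conjugation in the first argument of
      \<open>cip\<close> does not affect it.\<close>
    define r' where "r' = (\<lambda>x. of_real (1 / sqrt q) * r x)"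
    have r'W: "r' \<in> W" unfolding r'_def by (rule scale[OF rW])
    have r'r': "cip X r' r' = 1"
    proof -
      have "cip X r' r' = of_real (1 / sqrt q * (1 / sqrt q) * q)"
        unfolding r'_def cip_scale_left cip_scale_right q(2)
        by (simp only: of_real_mult complex_cnj_complex_of_real mult.assoc)
      also have "1 / sqrt q * (1 / sqrt q) * q = 1" using q(1) by (simp add: field_simps)
      finally show ?thesis by simp
    qed
    have o1: "cip X (u j) r' = 0" if "j < n" for j
      unfolding r'_def cip_scale_right using orth[OF that] by simp
    have o2: "cip X r' (u j) = 0" if "j < n" for j
      using o1[OF that] cip_commute[of X r' "u j"] by simp
    have "P (Suc n) (u(n := r'))"
      using u r'W r'r' o1 o2 by (auto simp: P_def less_Suc_eq)
    then show False using n(2) by fastforce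
  qed
  then have "\<forall>w\<in>W. \<forall>x. w x = (\<Sum>i<n. cip X (u i) w * u i x)" by (intro ballI allI)
  with u show ?thesis unfolding P_def
    by - (rule exI[of _ n], rule exI[of _ u], elim conjE, intro conjI)
qed

section \<open>Symmetric matrices\<close>

lemma finite_Xset [simp]: "finite (Xset d)"
  using finite_lists_length_eq[of "{0,1,2::nat}" d] by (simp add: Xset_def conj_commute)

lemma Xset_length: "y \<in> Xset d \<Longrightarrow> length y = d"
  by (simp add: Xset_def)

lemma Xset_nth: "y \<in> Xset d \<Longrightarrow> p < d \<Longrightarrow> y ! p \<in> {0,1,2}"
  unfolding Xset_def using nth_mem by blast

lemma Xset_update: "y \<in> Xset d \<Longrightarrow> j \<in> {0,1,2} \<Longrightarrow> y[p := j] \<in> Xset d"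
  using set_update_subset_insert[of y p j] by (auto simp: Xset_def)

lemma permw_eq_permute_list: "length y = d \<Longrightarrow> permw d \<sigma> y = permute_list \<sigma> y"
  by (simp add: permw_def permute_list_def)

lemma permutes_atLeastLessThan: "\<sigma> permutes {0..<d} \<longleftrightarrow> \<sigma> permutes {..<d::nat}"
  by (simp add: lessThan_atLeast0)

lemma length_permw [simp]: "length (permw d \<sigma> y) = d"
  by (simp add: permw_def)

lemma nth_permw [simp]: "i < d \<Longrightarrow> permw d \<sigma> y ! i = y ! \<sigma> i"
  by (simp add: permw_def)

lemma mset_permw: "\<sigma> permutes {0..<d} \<Longrightarrow> length y = d \<Longrightarrow> mset (permw d \<sigma> y) = mset y"
  by (simp add: permw_eq_permute_list permutes_atLeastLessThan mset_permute_list)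

lemma permw_in_Xset: "\<sigma> permutes {0..<d} \<Longrightarrow> y \<in> Xset d \<Longrightarrow> permw d \<sigma> y \<in> Xset d"
  using mset_eq_setD[OF mset_permw[of \<sigma> d y]] by (simp add: Xset_def)

lemma permutes_nat_less: "\<sigma> permutes {0..<d::nat} \<Longrightarrow> i < d \<Longrightarrow> \<sigma> i < d"
  using permutes_in_image[of \<sigma> "{0..<d}" i] by simp

lemma permw_compose:
  "\<tau> permutes {0..<d} \<Longrightarrow> \<sigma> permutes {0..<d} \<Longrightarrow> permw d \<sigma> (permw d \<tau> y) = permw d (\<tau> \<circ> \<sigma>) y"
  by (intro nth_equalityI) (simp_all add: permutes_nat_less)

lemma permw_id: "length y = d \<Longrightarrow> permw d id y = y"
  by (auto intro!: nth_equalityI)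

lemma bij_betw_permw:
  assumes "\<sigma> permutes {0..<d}"
  shows "bij_betw (permw d \<sigma>) (Xset d) (Xset d)"
proof (rule bij_betw_byWitness[where f' = "permw d (inv \<sigma>)"])
  have inv: "inv \<sigma> permutes {0..<d}" using assms by (rule permutes_inv)
  show "\<forall>y\<in>Xset d. permw d (inv \<sigma>) (permw d \<sigma> y) = y"
    using assms inv by (simp add: permw_compose permutes_inv_o permw_id Xset_length)
  show "\<forall>y\<in>Xset d. permw d \<sigma> (permw d (inv \<sigma>) y) = y"
    using assms inv by (simp add: permw_compose permutes_inv_o permw_id Xset_length)
  show "permw d \<sigma> ` Xset d \<subseteq> Xset d" "permw d (inv \<sigma>) ` Xset d \<subseteq> Xset d"
    using assms inv permw_in_Xset by blast+
qed

lemma sum_Xset_permw: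
  "\<sigma> permutes {0..<d} \<Longrightarrow> (\<Sum>y\<in>Xset d. f (permw d \<sigma> y)) = (\<Sum>y\<in>Xset d. f y)"
  by (rule sum.reindex_bij_betw[OF bij_betw_permw])

lemma SymMatI:
  assumes "\<And>y z. y \<notin> Xset d \<or> z \<notin> Xset d \<Longrightarrow> M y z = 0"
    and "\<And>\<sigma> y z. \<sigma> permutes {0..<d} \<Longrightarrow> y \<in> Xset d \<Longrightarrow> z \<in> Xset d \<Longrightarrow>
      M (permw d \<sigma> y) (permw d \<sigma> z) = M y z"
  shows "M \<in> SymMat d"
  using assms by (simp add: SymMat_def)

lemma SymMat_outside: "M \<in> SymMat d \<Longrightarrow> y \<notin> Xset d \<or> z \<notin> Xset d \<Longrightarrow> M y z = 0"
  by (auto simp: SymMat_def)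

lemma SymMat_permw:
  "M \<in> SymMat d \<Longrightarrow> \<sigma> permutes {0..<d} \<Longrightarrow> y \<in> Xset d \<Longrightarrow> z \<in> Xset d \<Longrightarrow>
    M (permw d \<sigma> y) (permw d \<sigma> z) = M y z"
  by (simp add: SymMat_def)

lemma SymMat_xadd: "M \<in> SymMat d \<Longrightarrow> N \<in> SymMat d \<Longrightarrow> xadd M N \<in> SymMat d"
  by (auto simp: SymMat_def xadd_def)

lemma SymMat_xscale: "M \<in> SymMat d \<Longrightarrow> xscale c M \<in> SymMat d"
  by (auto simp: SymMat_def xscale_def)

lemma SymMat_xmul:
  assumes M: "M \<in> SymMat d" and N: "N \<in> SymMat d"
  shows "xmul d M N \<in> SymMat d"
proof (rule SymMatI)
  fix y z assume "y \<notin> Xset d \<or> z \<notin> Xset d"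
  then show "xmul d M N y z = 0"
    using SymMat_outside[OF M] SymMat_outside[OF N] by (auto simp: xmul_def intro!: sum.neutral)
next
  fix \<sigma> y z assume *: "\<sigma> permutes {0..<d}" "y \<in> Xset d" "z \<in> Xset d"
  have "xmul d M N (permw d \<sigma> y) (permw d \<sigma> z)
      = (\<Sum>w\<in>Xset d. M (permw d \<sigma> y) (permw d \<sigma> w) * N (permw d \<sigma> w) (permw d \<sigma> z))"
    unfolding xmul_def by (rule sum_Xset_permw[OF *(1), symmetric])
  also have "\<dots> = xmul d M N y z"
    unfolding xmul_def using * SymMat_permw[OF M] SymMat_permw[OF N] by (intro sum.cong) auto
  finally show "xmul d M N (permw d \<sigma> y) (permw d \<sigma> z) = xmul d M N y z" .
qed

section \<open>Orbit matrices\<close>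

text \<open>Permuting both words simultaneously is the same as permuting the list of pairs, so the orbits
  of pairs of words are classified by the multiset of pairs of letters.\<close>

lemma SymMat_mset_cong:
  assumes M: "M \<in> SymMat d" and X: "y \<in> Xset d" "z \<in> Xset d" "y' \<in> Xset d" "z' \<in> Xset d"
    and eq: "mset (zip y z) = mset (zip y' z')"
  shows "M y z = M y' z'"
proof -
  have len: "length y = d" "length z = d" "length y' = d" "length z' = d"
    using X by (simp_all add: Xset_length)
  obtain \<sigma> where \<sigma>: "\<sigma> permutes {..<length (zip y' z')}" "permute_list \<sigma> (zip y' z') = zip y z"
    using mset_eq_permutation[OF eq] by blast
  then have p: "\<sigma> permutes {..<d}" using len by simp
  then have "zip (permute_list \<sigma> y') (permute_list \<sigma> z') = zip y z"
    using \<sigma> len by (simp add: permute_list_zip)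
  then have "permute_list \<sigma> y' = y" "permute_list \<sigma> z' = z"
    using len by (auto simp: zip_eq_conv)
  then show ?thesis
    using SymMat_permw[OF M _ X(3,4), of \<sigma>] p len
    by (simp add: permw_eq_permute_list permutes_atLeastLessThan)
qed

text \<open>The indicator of one orbit of pairs of words; it is the zero matrix when
  \<open>m\<close> is not in \<open>pairtypes d\<close>.\<close>

definition omat :: "nat \<Rightarrow> (nat \<times> nat) multiset \<Rightarrow> xmat" where
  "omat d m = (\<lambda>y z. of_bool (y \<in> Xset d \<and> z \<in> Xset d \<and> mset (zip y z) = m))"

definition pairtypes :: "nat \<Rightarrow> (nat \<times> nat) multiset set" where
  "pairtypes d = (\<lambda>(y, z). mset (zip y z)) ` (Xset d \<times> Xset d)"

lemma finite_pairtypes [simp]: "finite (pairtypes d)"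
  by (simp add: pairtypes_def)

lemma mset_zip_in_pairtypes: "y \<in> Xset d \<Longrightarrow> z \<in> Xset d \<Longrightarrow> mset (zip y z) \<in> pairtypes d"
  by (force simp: pairtypes_def)

lemma omat_SymMat: "omat d m \<in> SymMat d"
proof (rule SymMatI)
  fix \<sigma> y z assume *: "\<sigma> permutes {0..<d}" "y \<in> Xset d" "z \<in> Xset d"
  have "zip (permw d \<sigma> y) (permw d \<sigma> z) = permute_list \<sigma> (zip y z)"
    using * by (simp add: permw_eq_permute_list Xset_length permutes_atLeastLessThan permute_list_zip)
  then show "omat d m (permw d \<sigma> y) (permw d \<sigma> z) = omat d m y z"
    using * by (simp add: omat_def permw_in_Xset permutes_atLeastLessThan Xset_length)
qed (auto simp: omat_def)

text \<open>The coefficient of an orbit is the entry at a chosen representative \<open>r m\<close>;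
  by \<open>SymMat_mset_cong\<close> the choice does not matter. The second conjunct lets later
  arguments read coefficients off entries.\<close>

lemma SymMat_eq_sum_omat:
  assumes "M \<in> SymMat d"
  shows "\<exists>c. M = (\<lambda>y z. \<Sum>m\<in>pairtypes d. c m * omat d m y z) \<and>
    (\<forall>y\<in>Xset d. \<forall>z\<in>Xset d. c (mset (zip y z)) = M y z)"
proof -
  define r where "r m = (SOME q. fst q \<in> Xset d \<and> snd q \<in> Xset d \<and> mset (zip (fst q) (snd q)) = m)" for m
  define c where "c m = M (fst (r m)) (snd (r m))" for m
  have c: "c (mset (zip y z)) = M y z" if "y \<in> Xset d" "z \<in> Xset d" for y z
  proof -
    let ?q = "r (mset (zip y z))"
    have "fst ?q \<in> Xset d \<and> snd ?q \<in> Xset d \<and> mset (zip (fst ?q) (snd ?q)) = mset (zip y z)"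
      unfolding r_def by (rule someI[of _ "(y, z)"]) (use that in simp)
    then show ?thesis unfolding c_def using SymMat_mset_cong[OF assms _ _ that] by blast
  qed
  have "M y z = (\<Sum>m\<in>pairtypes d. c m * omat d m y z)" for y z
  proof (cases "y \<in> Xset d \<and> z \<in> Xset d")
    case True
    then have "(\<Sum>m\<in>pairtypes d. c m * omat d m y z)
        = (\<Sum>m\<in>pairtypes d. if mset (zip y z) = m then c m else 0)"
      by (intro sum.cong) (auto simp: omat_def)
    also have "\<dots> = M y z" using True c mset_zip_in_pairtypes by simp
    finally show ?thesis by simp
  next
    case False
    then show ?thesis using SymMat_outside[OF assms, of y z] by (auto simp: omat_def)
  qed
  then show ?thesis using c by (intro exI[of _ c]) auto
qed

text \<open>For irreflexive \<open>R\<close> this is the sum over all tensor positions of the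
  0/1-matrix of \<open>R\<close> at that position and the identity elsewhere. It gives a common form
  to \<open>adjA\<close>, \<open>adjAT\<close> and the operators \<open>dl\<close>.\<close>

definition onepos :: "nat \<Rightarrow> (nat \<Rightarrow> nat \<Rightarrow> bool) \<Rightarrow> xmat" where
  "onepos d R = (\<lambda>y z. of_bool (y \<in> Xset d \<and> z \<in> Xset d \<and>
     (\<exists>p<d. R (y ! p) (z ! p) \<and> (\<forall>q<d. q \<noteq> p \<longrightarrow> y ! q = z ! q))))"

lemma onepos_SymMat: "onepos d R \<in> SymMat d"
proof (rule SymMatI)
  fix \<sigma> y z assume *: "\<sigma> permutes {0..<d}" "y \<in> Xset d" "z \<in> Xset d"
  let ?Q = "\<lambda>y z p. R (y ! p) (z ! p) \<and> (\<forall>q<d. q \<noteq> p \<longrightarrow> y ! q = (z ! q :: nat))"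
  have \<sigma>: "\<sigma> p < d \<longleftrightarrow> p < d" for p using permutes_in_image[OF *(1), of p] by simp
  have Q: "?Q (permw d \<sigma> y) (permw d \<sigma> z) p \<longleftrightarrow> ?Q y z (\<sigma> p)" if "p < d" for p
  proof -
    have "(\<forall>q<d. q \<noteq> p \<longrightarrow> y ! \<sigma> q = z ! \<sigma> q) \<longleftrightarrow> (\<forall>q<d. q \<noteq> \<sigma> p \<longrightarrow> y ! q = z ! q)"
    proof safe
      fix q assume h: "\<forall>q<d. q \<noteq> p \<longrightarrow> y ! \<sigma> q = z ! \<sigma> q" "q < d" "q \<noteq> \<sigma> p"
      then have "inv \<sigma> q < d" "inv \<sigma> q \<noteq> p" "\<sigma> (inv \<sigma> q) = q"
        using \<sigma>[of "inv \<sigma> q"] permutes_inverses[OF *(1)] by auto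
      then show "y ! q = z ! q" using h(1) by metis
    next
      fix q assume h: "\<forall>q<d. q \<noteq> \<sigma> p \<longrightarrow> y ! q = z ! q" "q < d" "q \<noteq> p"
      then show "y ! \<sigma> q = z ! \<sigma> q"
        using \<sigma>[of q] permutes_inj[OF *(1)] by (auto dest: injD)
    qed
    then show ?thesis using that by simp
  qed
  have "(\<exists>p<d. ?Q (permw d \<sigma> y) (permw d \<sigma> z) p) \<longleftrightarrow> (\<exists>p<d. ?Q y z (\<sigma> p))"
    using Q by blast
  also have "\<dots> \<longleftrightarrow> (\<exists>p<d. ?Q y z p)"
  proof
    assume "\<exists>p<d. ?Q y z p"
    then obtain p where "p < d" "?Q y z p" by blast
    then show "\<exists>p<d. ?Q y z (\<sigma> p)"
      using \<sigma>[of "inv \<sigma> p"] permutes_inverses(1)[OF *(1), of p]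
      by (intro exI[of _ "inv \<sigma> p"]) simp
  qed (use \<sigma> in blast)
  finally show "onepos d R (permw d \<sigma> y) (permw d \<sigma> z) = onepos d R y z"
    using * by (simp add: onepos_def permw_in_Xset)
qed (auto simp: onepos_def)

lemma onepos_transpose: "onepos d R y z = onepos d (\<lambda>a b. R b a) z y"
proof -
  have "(\<exists>p<d. R (y ! p) (z ! p) \<and> (\<forall>q<d. q \<noteq> p \<longrightarrow> y ! q = z ! q)) \<longleftrightarrow>
      (\<exists>p<d. R (y ! p) (z ! p) \<and> (\<forall>q<d. q \<noteq> p \<longrightarrow> z ! q = y ! q))"
    by (simp only: eq_commute[of "y ! _"])
  then show ?thesis by (auto simp: onepos_def)
qed

lemma adjA_eq_onepos: "adjA d = onepos d (\<lambda>a b. b = (a + 1) mod 3)"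
  by (intro ext) (auto simp: adjA_def arc_def onepos_def)

lemma adjAT_eq_onepos: "adjAT d = onepos d (\<lambda>a b. a = (b + 1) mod 3)"
  unfolding adjAT_def adjA_eq_onepos by (intro ext onepos_transpose)

lemma cnt_eq_count: "cnt a y = count (mset y) a"
  by (induction y) (auto simp: cnt_def)

lemma Estar_SymMat: "Estar d s t \<in> SymMat d"
proof (rule SymMatI)
  fix \<sigma> y z assume *: "\<sigma> permutes {0..<d}" "y \<in> Xset d" "z \<in> Xset d"
  then show "Estar d s t (permw d \<sigma> y) (permw d \<sigma> z) = Estar d s t y z"
    using bij_betw_permw[OF *(1)]
    by (auto simp: Estar_def cnt_eq_count mset_permw Xset_length permw_in_Xset bij_betw_def inj_on_def)
qed (auto simp: Estar_def)

lemma xone_SymMat: "xone d \<in> SymMat d"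
proof (rule SymMatI)
  fix \<sigma> y z assume *: "\<sigma> permutes {0..<d}" "y \<in> Xset d" "z \<in> Xset d"
  then show "xone d (permw d \<sigma> y) (permw d \<sigma> z) = xone d y z"
    using bij_betw_permw[OF *(1)] by (auto simp: xone_def permw_in_Xset bij_betw_def inj_on_def)
qed (auto simp: xone_def)

lemma Terwilliger_subset_SymMat: "Terwilliger d \<subseteq> SymMat d"
proof
  fix M assume "M \<in> Terwilliger d"
  then show "M \<in> SymMat d"
    by induction (auto simp: adjA_eq_onepos adjAT_eq_onepos onepos_SymMat Estar_SymMat
        xone_SymMat SymMat_xadd SymMat_xscale SymMat_xmul)
qed

section \<open>Generation of the symmetric matrices by one-site operators\<close>

text \<open>For \<open>i \<noteq> j\<close> this is the matrix unit e_ij of gl_3 acting on the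
  tensor power by the Leibniz rule: on basis vectors it turns one letter \<open>j\<close> into
  \<open>i\<close>. It is a raising operator for \<open>i < j\<close> and a lowering operator for
  \<open>j < i\<close>.\<close>

definition dl :: "nat \<Rightarrow> nat \<Rightarrow> nat \<Rightarrow> xmat" where
  "dl d i j = onepos d (\<lambda>a b. a = i \<and> b = j)"

lemma dl_SymMat: "dl d i j \<in> SymMat d"
  by (simp add: dl_def onepos_SymMat)

lemma dl_transpose: "dl d i j y z = dl d j i z y"
  unfolding dl_def by (subst onepos_transpose) (simp add: conj_commute)

lemma dl_eq_update:
  assumes "y \<in> Xset d" "z \<in> Xset d"
  shows "dl d i j y z = of_bool (\<exists>p<d. y ! p = i \<and> z = y[p := j])"
proof -
  have len: "length y = d" "length z = d" using assms by (simp_all add: Xset_length)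
  have "(z ! p = j \<and> (\<forall>q<d. q \<noteq> p \<longrightarrow> y ! q = z ! q)) \<longleftrightarrow> z = y[p := j]" if "p < d" for p
    using that len by (auto simp: nth_list_update intro!: nth_equalityI)
  then show ?thesis using assms by (auto simp: dl_def onepos_def)
qed

lemma sum_dl:
  assumes y: "y \<in> Xset d" and ij: "i \<noteq> j" "j \<in> {0,1,2}"
  shows "(\<Sum>w\<in>Xset d. dl d i j y w * f w) = (\<Sum>p | p < d \<and> y ! p = i. f (y[p := j]))"
proof -
  let ?P = "{p. p < d \<and> y ! p = i}"
  have len: "length y = d" using y by (simp add: Xset_length)
  have inj: "inj_on (\<lambda>p. y[p := j]) ?P"
  proof (rule inj_onI)
    fix p q assume *: "p \<in> ?P" "q \<in> ?P" "y[p := j] = y[q := j]"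
    then have "y[p := j] ! p = y[q := j] ! p" by (simp only:)
    then show "p = q" using *(1,2) len ij(1) by (cases "p = q") auto
  qed
  have "(\<Sum>w\<in>Xset d. dl d i j y w * f w) = (\<Sum>w\<in>Xset d. if w \<in> (\<lambda>p. y[p := j]) ` ?P then f w else 0)"
    using y by (intro sum.cong) (auto simp: dl_eq_update)
  also have "\<dots> = (\<Sum>w\<in>Xset d \<inter> (\<lambda>p. y[p := j]) ` ?P. f w)"
    by (simp add: sum.inter_restrict)
  also have "Xset d \<inter> (\<lambda>p. y[p := j]) ` ?P = (\<lambda>p. y[p := j]) ` ?P"
    using y ij Xset_update by blast
  also have "(\<Sum>w\<in>(\<lambda>p. y[p := j]) ` ?P. f w) = (\<Sum>p\<in>?P. f (y[p := j]))"
    by (simp add: sum.reindex[OF inj])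
  finally show ?thesis .
qed

text \<open>Both sides carry one extra pair, which avoids multiset subtraction and lets
  \<open>offdiag\<close> be compared directly.\<close>

lemma mset_zip_update:
  assumes "p < length y" "length z = length y"
  shows "add_mset (y ! p, z ! p) (mset (zip (y[p := j]) z)) = add_mset (j, z ! p) (mset (zip y z))"
proof -
  have "zip (y[p := j]) z = (zip y z)[p := (j, z ! p)]"
    using update_zip[of y z p "(j, z ! p)"] by simp
  moreover have "zip y z ! p \<in># mset (zip y z)" using assms by (simp del: nth_zip)
  ultimately show ?thesis using assms by (simp add: mset_update insert_DiffM)
qed

text \<open>The measure for the induction over orbits.\<close>

definition offdiag :: "(nat \<times> nat) multiset \<Rightarrow> nat" where
  "offdiag m = size (filter_mset (\<lambda>q. fst q \<noteq> snd q) m)"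

lemma offdiag_add_mset [simp]: "offdiag (add_mset q m) = of_bool (fst q \<noteq> snd q) + offdiag m"
  by (simp add: offdiag_def)

text \<open>Multiplying by \<^term>\<open>dl d i j\<close> has the required orbit as its only term with the maximal
  number of off-diagonal pairs.\<close>

lemma dl_omat_leading:
  fixes m0 :: "(nat \<times> nat) multiset"
  assumes ij: "i \<noteq> j" "j \<in> {0,1,2}" and X: "y \<in> Xset d" "z \<in> Xset d"
  defines "N \<equiv> xmul d (dl d i j) (omat d (add_mset (j, j) m0))"
  shows "N y z \<noteq> 0 \<Longrightarrow> mset (zip y z) = add_mset (i, j) m0 \<or> offdiag (mset (zip y z)) \<le> offdiag m0"
    and "mset (zip y z) = add_mset (i, j) m0 \<Longrightarrow> N y z \<noteq> 0"
proof -
  have len: "length y = d" "length z = d" using X by (simp_all add: Xset_length)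
  let ?P = "{p. p < d \<and> y ! p = i}" and ?m = "add_mset (j, j) m0"
  have N: "N y z = (\<Sum>p\<in>?P. of_bool (mset (zip (y[p := j]) z) = ?m))"
    unfolding N_def xmul_def sum_dl[OF X(1) ij]
    using X ij by (intro sum.cong) (auto simp: omat_def Xset_update)
  have upd: "add_mset (i, z ! p) (mset (zip (y[p := j]) z)) = add_mset (j, z ! p) (mset (zip y z))"
    if "p \<in> ?P" for p using mset_zip_update[of p y z j] that len by simp
  {
    assume "N y z \<noteq> 0"
    then obtain p where p: "p \<in> ?P" "mset (zip (y[p := j]) z) = ?m"
      unfolding N by (auto dest!: sum.not_neutral_contains_not_neutral)
    then have eq: "add_mset (i, z ! p) ?m = add_mset (j, z ! p) (mset (zip y z))" using upd by metis
    show "mset (zip y z) = add_mset (i, j) m0 \<or> offdiag (mset (zip y z)) \<le> offdiag m0"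
    \<comment> \<open>If the changed letter faces \<open>j\<close>, the type is exactly the required
      one. Otherwise \<open>(j, z ! p)\<close> is off-diagonal on the right of \<open>eq\<close>, so
      the type of \<open>(y, z)\<close> has at most as many off-diagonal pairs as
      \<open>m0\<close>.\<close>
    proof (cases "z ! p = j")
      case True
      then show ?thesis using eq by (simp add: add_mset_commute)
    next
      case False
      then show ?thesis using arg_cong[OF eq, of offdiag] by (auto simp: of_bool_def split: if_splits)
    qed
  }
  {
    assume t: "mset (zip y z) = add_mset (i, j) m0"
    then have "(i, j) \<in> set (zip y z)" by (metis set_mset_mset union_single_eq_member)
    then obtain p where p: "p < d" "y ! p = i" "z ! p = j" using len by (auto simp: set_zip)
    then have "mset (zip (y[p := j]) z) = ?m" using upd[of p] t by (simp add: add_mset_commute)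
    then have "{p \<in> ?P. mset (zip (y[p := j]) z) = ?m} \<noteq> {}" using p by blast
    \<comment> \<open>The entry counts positions, so a single suitable position makes it nonzero in
      characteristic zero; nothing can cancel.\<close>
    moreover have "N y z = of_nat (card {p \<in> ?P. mset (zip (y[p := j]) z) = ?m})"
      unfolding N by (simp add: of_bool_def sum.If_cases Int_def)
    ultimately show "N y z \<noteq> 0" by simp
  }
qed

lemma image_mset_swap_eq: "image_mset prod.swap m = m' \<longleftrightarrow> m = image_mset prod.swap m'"
  by (auto simp: multiset.map_comp)

lemma mset_zip_swap: "length y = length z \<Longrightarrow> mset (zip z y) = image_mset prod.swap (mset (zip y z))"
  by (induction y z rule: list_induct2) auto

lemma offdiag_swap: "offdiag (image_mset prod.swap m) = offdiag m"
  by (induction m) auto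

lemma omat_transpose: "omat d m y z = omat d (image_mset prod.swap m) z y"
  by (auto simp: omat_def Xset_length mset_zip_swap[of y z] image_mset_swap_eq multiset.map_comp)

text \<open>This follows from \<open>dl_omat_leading\<close> by transposition, which swaps the pairs
  and preserves \<open>offdiag\<close>.\<close>

lemma omat_dl_leading:
  fixes m0 :: "(nat \<times> nat) multiset"
  assumes ij: "i \<noteq> j" "i \<in> {0,1,2}" and X: "y \<in> Xset d" "z \<in> Xset d"
  defines "N \<equiv> xmul d (omat d (add_mset (i, i) m0)) (dl d i j)"
  shows "N y z \<noteq> 0 \<Longrightarrow> mset (zip y z) = add_mset (i, j) m0 \<or> offdiag (mset (zip y z)) \<le> offdiag m0"
    and "mset (zip y z) = add_mset (i, j) m0 \<Longrightarrow> N y z \<noteq> 0"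
proof -
  let ?m0 = "image_mset prod.swap m0"
  have N: "N y z = xmul d (dl d j i) (omat d (add_mset (i, i) ?m0)) z y"
    unfolding N_def xmul_def
    by (intro sum.cong) (simp_all add: omat_transpose[of d _ y] dl_transpose[of d i j] mult.commute)
  have sw: "mset (zip z y) = image_mset prod.swap (mset (zip y z))"
    using X by (intro mset_zip_swap) (simp add: Xset_length)
  have eq: "mset (zip z y) = add_mset (j, i) ?m0 \<longleftrightarrow> mset (zip y z) = add_mset (i, j) m0"
    unfolding sw image_mset_swap_eq by (simp add: multiset.map_comp)
  show "N y z \<noteq> 0 \<Longrightarrow> mset (zip y z) = add_mset (i, j) m0 \<or> offdiag (mset (zip y z)) \<le> offdiag m0"
    "mset (zip y z) = add_mset (i, j) m0 \<Longrightarrow> N y z \<noteq> 0"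
    using dl_omat_leading[OF ij(1)[symmetric] ij(2) X(2,1), of ?m0]
    unfolding N eq by (simp_all add: sw offdiag_swap)
qed

text \<open>Induction on \<open>offdiag\<close>: an off-diagonal pair \<open>(i, j)\<close> is
  recovered from an orbit with one such pair fewer by multiplying with \<open>dl d i j\<close>, on
  the left if it lowers and on the right if it raises. The choice of sides is what makes the
  principle usable on highest weight vectors, besides its use for generation.\<close>

lemma SymMat_induct [consumes 1, case_names add scale diag lower upper]:
  assumes M: "M \<in> SymMat d"
    and add: "\<And>M N. P M \<Longrightarrow> P N \<Longrightarrow> P (xadd M N)"
    and scale: "\<And>M c. P M \<Longrightarrow> P (xscale c M)"
    and diag: "\<And>m. (\<And>q. q \<in># m \<Longrightarrow> fst q = snd q) \<Longrightarrow> P (omat d m)"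
    and lower: "\<And>i j M. i \<in> {0,1,2} \<Longrightarrow> j \<in> {0,1,2} \<Longrightarrow> j < i \<Longrightarrow> M \<in> SymMat d \<Longrightarrow> P M \<Longrightarrow>
      P (xmul d (dl d i j) M)"
    and upper: "\<And>i j M. i \<in> {0,1,2} \<Longrightarrow> j \<in> {0,1,2} \<Longrightarrow> i < j \<Longrightarrow> M \<in> SymMat d \<Longrightarrow> P M \<Longrightarrow>
      P (xmul d M (dl d i j))"
  shows "P M"
proof -
  have zero: "P (\<lambda>y z. 0)"
    using scale[OF diag[of "{#}"], of 0] by (simp add: xscale_def)
  have sum: "P (\<lambda>y z. \<Sum>m\<in>A. c m * omat d m y z)"
    if "finite A" "\<And>m. m \<in> A \<Longrightarrow> c m \<noteq> 0 \<Longrightarrow> P (omat d m)" for A c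
    using that
  proof (induction A rule: finite_induct)
    case (insert m A)
    have "P (xscale (c m) (omat d m))"
      using insert.prems[of m] scale zero by (cases "c m = 0") (auto simp: xscale_def)
    then have "P (xadd (xscale (c m) (omat d m)) (\<lambda>y z. \<Sum>m\<in>A. c m * omat d m y z))"
      using insert by (intro add) auto
    then show ?case using insert by (simp add: xadd_def xscale_def)
  qed (simp add: zero)
  \<comment> \<open>Here \<open>N\<close> contains the orbit \<open>m\<close> with nonzero
    coefficient and otherwise only orbits with fewer off-diagonal pairs; these are subtracted and
    the result is divided by the coefficient of \<open>m\<close>.\<close>
  have leading: "P (omat d m)"
    if N: "N \<in> SymMat d" "P N"
      and IH: "\<And>m'. offdiag m' < offdiag m \<Longrightarrow> P (omat d m')"
      and small: "\<And>y z. y \<in> Xset d \<Longrightarrow> z \<in> Xset d \<Longrightarrow> N y z \<noteq> 0 \<Longrightarrow>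
        mset (zip y z) = m \<or> offdiag (mset (zip y z)) < offdiag m"
      and lead: "\<And>y z. y \<in> Xset d \<Longrightarrow> z \<in> Xset d \<Longrightarrow> mset (zip y z) = m \<Longrightarrow> N y z \<noteq> 0"
    for N m
  proof (cases "m \<in> pairtypes d")
    case False
    then have "omat d m = (\<lambda>y z. 0)" by (intro ext) (auto simp: omat_def mset_zip_in_pairtypes)
    then show ?thesis using zero by simp
  next
    case True
    obtain c where c: "N = (\<lambda>y z. \<Sum>m\<in>pairtypes d. c m * omat d m y z)"
      "\<forall>y\<in>Xset d. \<forall>z\<in>Xset d. c (mset (zip y z)) = N y z"
      using SymMat_eq_sum_omat[OF N(1)] by blast
    have cm: "c m \<noteq> 0" using True c(2) lead by (auto simp: pairtypes_def)
    let ?R = "\<lambda>y z. \<Sum>m'\<in>pairtypes d - {m}. c m' * omat d m' y z"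
    have "P ?R"
    proof (rule sum)
      fix m' assume "m' \<in> pairtypes d - {m}" "c m' \<noteq> 0"
      then have "offdiag m' < offdiag m" using c(2) small by (force simp: pairtypes_def)
      then show "P (omat d m')" by (rule IH)
    qed simp
    then have "P (xscale (1 / c m) (xadd N (xscale (- 1) ?R)))" using N scale add by blast
    moreover have "xscale (1 / c m) (xadd N (xscale (- 1) ?R)) = omat d m"
    proof (intro ext)
      fix y z
      have "N y z = c m * omat d m y z + ?R y z"
        unfolding c(1) using True by (simp add: sum.remove)
      then show "xscale (1 / c m) (xadd N (xscale (- 1) ?R)) y z = omat d m y z"
        using cm by (simp add: xscale_def xadd_def)
    qed
    ultimately show ?thesis by simp
  qed
  have "P (omat d m)" if "m \<in> pairtypes d" for m
    using that
  proof (induction "offdiag m" arbitrary: m rule: less_induct)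
    case less
    have IH: "P (omat d m')" if "offdiag m' < offdiag m" for m'
    proof (cases "m' \<in> pairtypes d")
      case True
      then show ?thesis using less that by blast
    next
      case False
      then have "omat d m' = (\<lambda>y z. 0)" by (intro ext) (auto simp: omat_def mset_zip_in_pairtypes)
      then show ?thesis using zero by simp
    qed
    show ?case
    proof (cases "\<forall>q. q \<in># m \<longrightarrow> fst q = snd q")
      case True
      then show ?thesis using diag by blast
    next
      case False
      then obtain i j where ij: "(i, j) \<in># m" "i \<noteq> j" by auto
      then obtain m0 where m0: "m = add_mset (i, j) m0" by (meson mset_add)
      have range: "i \<in> {0,1,2}" "j \<in> {0,1,2}"
      proof -
        obtain y z where yz: "y \<in> Xset d" "z \<in> Xset d" "m = mset (zip y z)"
          using less.prems by (auto simp: pairtypes_def)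
        then have "i \<in> set y" "j \<in> set z"
          using ij(1) by (auto dest: set_zip_leftD set_zip_rightD)
        then show "i \<in> {0,1,2}" "j \<in> {0,1,2}" using yz unfolding Xset_def by blast+
      qed
      show ?thesis
      proof (cases "j < i")
        case True
        \<comment> \<open>Replacing \<open>(i, j)\<close> by \<open>(j, j)\<close> removes one
          off-diagonal pair, so the induction hypothesis covers \<open>?M\<close>.\<close>
        let ?M = "omat d (add_mset (j, j) m0)"
        have "P ?M" using IH ij m0 by simp
        have "xmul d (dl d i j) ?M \<in> SymMat d"
          by (intro SymMat_xmul dl_SymMat omat_SymMat)
        moreover have "P (xmul d (dl d i j) ?M)" using \<open>P ?M\<close> by (intro lower range True omat_SymMat)
        ultimately show ?thesis
        proof (rule leading[of "xmul d (dl d i j) ?M"])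
          fix y z assume "y \<in> Xset d" "z \<in> Xset d"
          note L = dl_omat_leading[OF ij(2) range(2) this, of m0]
          show "mset (zip y z) = m \<or> offdiag (mset (zip y z)) < offdiag m" if "(xmul d (dl d i j) ?M) y z \<noteq> 0"
            using L(1)[OF that] ij(2) m0 by (simp add: less_Suc_eq_le)
          show "(xmul d (dl d i j) ?M) y z \<noteq> 0" if "mset (zip y z) = m" using L(2) that m0 by simp
        qed (rule IH)
      next
        case False
        let ?M = "omat d (add_mset (i, i) m0)"
        have "P ?M" using IH ij m0 by simp
        have "xmul d ?M (dl d i j) \<in> SymMat d"
          by (intro SymMat_xmul dl_SymMat omat_SymMat)
        moreover have "P (xmul d ?M (dl d i j))" using \<open>P ?M\<close> False ij by (intro upper range omat_SymMat) auto
        ultimately show ?thesis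
        proof (rule leading[of "xmul d ?M (dl d i j)"])
          fix y z assume "y \<in> Xset d" "z \<in> Xset d"
          note L = omat_dl_leading[OF ij(2) range(1) this, of m0]
          show "mset (zip y z) = m \<or> offdiag (mset (zip y z)) < offdiag m" if "(xmul d ?M (dl d i j)) y z \<noteq> 0"
            using L(1)[OF that] ij(2) m0 by (simp add: less_Suc_eq_le)
          show "(xmul d ?M (dl d i j)) y z \<noteq> 0" if "mset (zip y z) = m" using L(2) that m0 by simp
        qed (rule IH)
      qed
    qed
  qed
  then show ?thesis using SymMat_eq_sum_omat[OF M] sum[of "pairtypes d"] by auto
qed

section \<open>One-letter operators in the Terwilliger algebra\<close>

lemma Terwilliger_sum:
  assumes "finite I" and "\<And>i. i \<in> I \<Longrightarrow> f i \<in> Terwilliger d"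
  shows "(\<lambda>y z. \<Sum>i\<in>I. f i y z) \<in> Terwilliger d"
  using assms
proof (induction I rule: finite_induct)
  case empty
  then show ?case using Terwilliger.scale[OF Terwilliger.one, of 0] by (simp add: xscale_def)
next
  case (insert i I)
  then have "xadd (f i) (\<lambda>y z. \<Sum>i\<in>I. f i y z) \<in> Terwilliger d"
    by (intro Terwilliger.add) auto
  then show ?case using insert by (simp add: xadd_def)
qed

lemma xmul_Estar_left:
  "xmul d (Estar d s t) M y z = of_bool (y \<in> Xset d \<and> int (cnt 1 y) = s \<and> int (cnt 2 y) = t) * M y z"
proof -
  have "xmul d (Estar d s t) M y z = (\<Sum>w\<in>Xset d. if y = w then
      of_bool (y \<in> Xset d \<and> int (cnt 1 y) = s \<and> int (cnt 2 y) = t) * M y z else 0)"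
    unfolding xmul_def by (intro sum.cong) (auto simp: Estar_def)
  then show ?thesis by simp
qed

lemma xmul_Estar_right:
  "xmul d M (Estar d s t) y z = of_bool (z \<in> Xset d \<and> int (cnt 1 z) = s \<and> int (cnt 2 z) = t) * M y z"
proof -
  have "xmul d M (Estar d s t) y z = (\<Sum>w\<in>Xset d. if z = w then
      of_bool (z \<in> Xset d \<and> int (cnt 1 z) = s \<and> int (cnt 2 z) = t) * M y z else 0)"
    unfolding xmul_def by (intro sum.cong) (auto simp: Estar_def)
  then show ?thesis by simp
qed

text \<open>Compressing \<open>M\<close> between the projector of weight \<open>(s, t)\<close> and
  that of weight \<open>(s + \<alpha>, t + \<beta>)\<close> and summing over all
  \<open>(s, t)\<close> keeps exactly the entries with this change of weight. Integer weights allow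
  negative shifts.\<close>

lemma Terwilliger_weight_shift:
  assumes M: "M \<in> Terwilliger d"
  shows "(\<lambda>y z. of_bool (int (cnt 1 z) = int (cnt 1 y) + \<alpha> \<and> int (cnt 2 z) = int (cnt 2 y) + \<beta>) * M y z)
    \<in> Terwilliger d"
proof -
  let ?I = "{0..int d} \<times> {0..int d}"
  let ?f = "\<lambda>(s, t). xmul d (xmul d (Estar d s t) M) (Estar d (s + \<alpha>) (t + \<beta>))"
  have "(\<lambda>y z. \<Sum>q\<in>?I. ?f q y z) \<in> Terwilliger d"
    using M by (intro Terwilliger_sum) (auto intro!: Terwilliger.intros)
  moreover have "(\<Sum>q\<in>?I. ?f q y z) =
      of_bool (int (cnt 1 z) = int (cnt 1 y) + \<alpha> \<and> int (cnt 2 z) = int (cnt 2 y) + \<beta>) * M y z"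
    (is "_ = ?r") for y z
  proof (cases "y \<in> Xset d \<and> z \<in> Xset d")
    case True
    let ?w = "(int (cnt 1 y), int (cnt 2 y))"
    have "cnt a y \<le> d" for a
      using True length_filter_le[of "\<lambda>x. x = a" y] by (auto simp: cnt_def dest: Xset_length)
    then have w: "?w \<in> ?I" by simp
    have "(\<Sum>q\<in>?I. ?f q y z) = (\<Sum>q\<in>?I. if ?w = q then ?r else 0)"
      using True by (intro sum.cong) (auto simp: xmul_Estar_left xmul_Estar_right)
    also have "\<dots> = ?r" using w by (simp only: sum.delta' finite_SigmaI finite_atLeastAtMost_int if_True)
    finally show ?thesis .
  next
    case False
    then have "M y z = 0" using M Terwilliger_subset_SymMat SymMat_outside by blast
    then show ?thesis by (simp add: xmul_Estar_left xmul_Estar_right case_prod_unfold)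
  qed
  ultimately show ?thesis by simp
qed

lemma cnt_update:
  assumes "p < length y"
  shows "int (cnt a (y[p := j])) = int (cnt a y) + of_bool (j = a) - of_bool (y ! p = a)"
proof -
  have "count (mset y) (y ! p) > 0" using assms by simp
  then show ?thesis using assms by (auto simp: cnt_eq_count mset_update of_bool_def)
qed

text \<open>Along an arc the changed letter goes from 0 to 1, 1 to 2 or 2 to 0, and the numbers of
  letters 1 and 2 change by (1,0), (-1,1) or (0,-1). These changes are distinct, so a weight shift
  isolates each kind in \<open>adjA\<close>, and the reversed kinds in \<open>adjAT\<close>.\<close>

lemma dl_Terwilliger:
  assumes ij: "i \<in> {0,1,2}" "j \<in> {0,1,2}" "i \<noteq> j"
  shows "dl d i j \<in> Terwilliger d"
proof -
  define R where "R = (\<lambda>a b. if j = (i + 1) mod 3 then b = (a + 1) mod 3 else a = ((b + 1) mod 3 :: nat))"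
  define \<alpha> where "\<alpha> = of_bool (j = 1) - (of_bool (i = 1) :: int)"
  define \<beta> where "\<beta> = of_bool (j = 2) - (of_bool (i = 2) :: int)"
  have T: "onepos d R \<in> Terwilliger d"
    using Terwilliger.gen_A[of d] Terwilliger.gen_AT[of d]
    unfolding adjA_eq_onepos adjAT_eq_onepos R_def by (cases "j = (i + 1) mod 3") simp_all
  have key: "(of_bool (b = 1) - of_bool (a = 1) = \<alpha> \<and> of_bool (b = 2) - of_bool (a = 2) = \<beta> \<and> R a b) \<longleftrightarrow>
      a = i \<and> b = j" if "a \<in> {0,1,2}" "b \<in> {0,1,2}" for a b
    using that ij by (auto simp: R_def \<alpha>_def \<beta>_def)
  have "dl d i j y z = of_bool (int (cnt 1 z) = int (cnt 1 y) + \<alpha> \<and> int (cnt 2 z) = int (cnt 2 y) + \<beta>)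
      * onepos d R y z" for y z
  proof (cases "y \<in> Xset d \<and> z \<in> Xset d")
    case True
    then have len: "length y = d" "length z = d" by (simp_all add: Xset_length)
    let ?Q = "\<lambda>p. \<forall>q<d. q \<noteq> p \<longrightarrow> y ! q = z ! q"
    let ?C = "int (cnt 1 z) = int (cnt 1 y) + \<alpha> \<and> int (cnt 2 z) = int (cnt 2 y) + \<beta>"
    have "?C \<and> R (y ! p) (z ! p) \<longleftrightarrow> y ! p = i \<and> z ! p = j" if p: "p < d" "?Q p" for p
    proof -
      have z: "z = y[p := z ! p]"
        using p len by (intro nth_equalityI) (auto simp: nth_list_update)
      have c: "int (cnt a z) = int (cnt a y) + of_bool (z ! p = a) - of_bool (y ! p = a)" for a
        using cnt_update[of p y a "z ! p"] z p len by simp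
      have "?C \<longleftrightarrow> of_bool (z ! p = 1) - of_bool (y ! p = 1) = \<alpha> \<and>
          of_bool (z ! p = 2) - of_bool (y ! p = 2) = \<beta>"
        unfolding c by auto
      then show ?thesis
        using key[of "y ! p" "z ! p"] True p(1) Xset_nth by blast
    qed
    then have "?C \<and> (\<exists>p<d. R (y ! p) (z ! p) \<and> ?Q p) \<longleftrightarrow> (\<exists>p<d. (y ! p = i \<and> z ! p = j) \<and> ?Q p)"
      by blast
    then show ?thesis using True by (auto simp: dl_def onepos_def of_bool_def)
  qed (auto simp: dl_def onepos_def)
  then have "dl d i j = (\<lambda>y z. of_bool (int (cnt 1 z) = int (cnt 1 y) + \<alpha> \<and>
      int (cnt 2 z) = int (cnt 2 y) + \<beta>) * onepos d R y z)" by (intro ext)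
  then show ?thesis using Terwilliger_weight_shift[OF T] by simp
qed

lemma cnt_sum: "set y \<subseteq> {0,1,2} \<Longrightarrow> cnt 0 y + cnt 1 y + cnt 2 y = length y"
  by (induction y) (auto simp: cnt_def)

lemma mset_eq_if_cnt_eq:
  assumes "y \<in> Xset d" "z \<in> Xset d" "cnt 1 y = cnt 1 z" "cnt 2 y = cnt 2 z"
  shows "mset y = mset z"
proof (rule multiset_eqI)
  fix a
  have "cnt 0 y = cnt 0 z" using assms cnt_sum[of y] cnt_sum[of z] by (simp add: Xset_def)
  then have "cnt a y = cnt a z" if "a \<in> {0,1,2}" using assms that by fastforce
  then show "count (mset y) a = count (mset z) a"
  proof (cases "a \<in> {0,1,2}")
    case False
    then have "a \<notin> set y" "a \<notin> set z" using assms(1,2) unfolding Xset_def by blast+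
    then show ?thesis by (simp add: count_eq_zero_iff[THEN iffD2])
  qed (simp add: cnt_eq_count)
qed

text \<open>A diagonal type forces both words to coincide, and the multiset of letters of a word in
  \<open>Xset d\<close> is determined by its numbers of letters 1 and 2.\<close>

lemma omat_diagonal:
  assumes m: "\<And>q. q \<in># m \<Longrightarrow> fst q = snd q"
  shows "omat d m = (\<lambda>y z. 0) \<or> (\<exists>s t. omat d m = Estar d s t)"
proof (cases "m \<in> pairtypes d")
  case False
  then show ?thesis by (intro disjI1 ext) (auto simp: omat_def mset_zip_in_pairtypes)
next
  case True
  have diag: "z = y" if "y \<in> Xset d" "z \<in> Xset d" "mset (zip y z) = m" for y z
  proof (rule nth_equalityI)
    have len: "length y = d" "length z = d" using that by (simp_all add: Xset_length)
    then show "length z = length y" by simp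
    fix i assume "i < length z"
    then have "(y ! i, z ! i) \<in> set (zip y z)" using len by (auto simp: set_zip)
    then have "(y ! i, z ! i) \<in># m" using that(3) by (metis set_mset_mset)
    then show "z ! i = y ! i" using m by fastforce
  qed
  obtain y0 where y0: "y0 \<in> Xset d" "mset (zip y0 y0) = m"
    using True diag by (auto simp: pairtypes_def)
  have zip: "mset (zip y y) = image_mset (\<lambda>x. (x, x)) (mset y)" for y :: "nat list"
    by (induction y) auto
  have "omat d m y z = Estar d (int (cnt 1 y0)) (int (cnt 2 y0)) y z" for y z
  proof (cases "y \<in> Xset d \<and> z = y")
    case True
    have "mset (zip y y) = m \<longleftrightarrow> mset y = mset y0"
    proof
      assume "mset (zip y y) = m"
      then have "image_mset fst (mset (zip y y)) = image_mset fst (mset (zip y0 y0))" using y0 by simp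
      then show "mset y = mset y0" unfolding zip by (simp add: multiset.map_comp comp_def)
    qed (use y0 in \<open>simp add: zip\<close>)
    also have "\<dots> \<longleftrightarrow> cnt 1 y = cnt 1 y0 \<and> cnt 2 y = cnt 2 y0"
      using mset_eq_if_cnt_eq[of y d y0] True y0 by (auto simp: cnt_eq_count)
    finally show ?thesis using True by (auto simp: omat_def Estar_def)
  next
    case False
    then show ?thesis using diag by (auto simp: omat_def Estar_def)
  qed
  then show ?thesis by blast
qed

theorem Terwilliger_eq_SymMat: "Terwilliger d = SymMat d"
proof (rule antisym[OF Terwilliger_subset_SymMat subsetI])
  fix M assume "M \<in> SymMat d"
  then show "M \<in> Terwilliger d"
  proof (induction rule: SymMat_induct)
    case (diag m)
    have "(\<lambda>y z. 0) \<in> Terwilliger d"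
      using Terwilliger.scale[OF Terwilliger.one, of 0] by (simp add: xscale_def)
    then show ?case using omat_diagonal[of m d, OF diag] Terwilliger.gen_E by metis
  qed (assumption | rule Terwilliger.add Terwilliger.scale Terwilliger.mul dl_Terwilliger
      | simp only: nat_neq_iff simp_thms)+
qed

section \<open>Highest weight vectors\<close>

definition xapp :: "nat \<Rightarrow> xmat \<Rightarrow> (nat list \<Rightarrow> complex) \<Rightarrow> nat list \<Rightarrow> complex" where
  "xapp d M v = (\<lambda>y. \<Sum>z\<in>Xset d. M y z * v z)"

lemma xapp_xadd: "xapp d (xadd M N) v = (\<lambda>y. xapp d M v y + xapp d N v y)"
  by (simp add: xapp_def xadd_def distrib_right sum.distrib)

lemma xapp_xscale: "xapp d (xscale c M) v = (\<lambda>y. c * xapp d M v y)"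
  by (simp add: xapp_def xscale_def sum_distrib_left mult.assoc)

lemma xapp_xmul: "xapp d (xmul d M N) v = xapp d M (xapp d N v)"
  unfolding xapp_def xmul_def
  by (intro ext) (simp add: sum_distrib_left sum_distrib_right mult.assoc, rule sum.swap)

lemma xapp_scale: "xapp d M (\<lambda>y. c * v y) = (\<lambda>y. c * xapp d M v y)"
  by (simp add: xapp_def sum_distrib_left mult_ac)

lemma xapp_zero [simp]: "xapp d M (\<lambda>y. 0) = (\<lambda>y. 0)"
  by (simp add: xapp_def)

lemma xapp_outside: "M \<in> SymMat d \<Longrightarrow> y \<notin> Xset d \<Longrightarrow> xapp d M v y = 0"
  by (simp add: xapp_def SymMat_outside)

lemma cip_xapp: "cip (Xset d) v (xapp d M w) = cip (Xset d) (xapp d (\<lambda>y z. cnj (M z y)) v) w"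
  unfolding cip_def xapp_def
  by (simp add: sum_distrib_left sum_distrib_right mult_ac, rule sum.swap)

lemma SymMat_adjoint: "M \<in> SymMat d \<Longrightarrow> (\<lambda>y z. cnj (M z y)) \<in> SymMat d"
  by (auto simp: SymMat_def)

definition hwv :: "nat \<Rightarrow> nat \<Rightarrow> nat \<Rightarrow> (nat list \<Rightarrow> complex) \<Rightarrow> bool" where
  "hwv d s t v \<longleftrightarrow> (\<forall>y. v y \<noteq> 0 \<longrightarrow> y \<in> Xset d \<and> cnt 1 y = s \<and> cnt 2 y = t) \<and>
     (\<forall>i j. i < j \<longrightarrow> j \<le> 2 \<longrightarrow> xapp d (dl d i j) v = (\<lambda>y. 0))"

lemma hwv_orthogonal:
  assumes "hwv d s t v" "hwv d s' t' v'" "(s, t) \<noteq> (s', t')"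
  shows "cip (Xset d) v v' = 0"
proof -
  have "v y = 0 \<or> v' y = 0" for y using assms unfolding hwv_def by blast
  then show ?thesis unfolding cip_def by (intro sum.neutral) auto
qed

text \<open>Modulo lowering operators on the left and raising operators on the right every symmetric
  matrix is diagonal, and diagonal ones act on a weight vector as scalars.\<close>

lemma SymMat_hwv_scalar:
  assumes M: "M \<in> SymMat d" and v: "hwv d s t v"
  shows "\<exists>c. \<forall>s' t' v'. hwv d s' t' v' \<longrightarrow> cip (Xset d) v' (xapp d M v) = c * cip (Xset d) v' v"
  using M
proof (induction rule: SymMat_induct)
  case (add M N)
  then obtain a b where "\<forall>s' t' v'. hwv d s' t' v' \<longrightarrow> cip (Xset d) v' (xapp d M v) = a * cip (Xset d) v' v"
    "\<forall>s' t' v'. hwv d s' t' v' \<longrightarrow> cip (Xset d) v' (xapp d N v) = b * cip (Xset d) v' v" by blast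
  then show ?case by (intro exI[of _ "a + b"]) (simp add: xapp_xadd cip_add_right distrib_right)
next
  case (scale M c)
  then obtain a where "\<forall>s' t' v'. hwv d s' t' v' \<longrightarrow> cip (Xset d) v' (xapp d M v) = a * cip (Xset d) v' v"
    by blast
  then show ?case by (intro exI[of _ "c * a"]) (simp add: xapp_xscale cip_scale_right)
next
  case (diag m)
  have "xapp d (Estar d a b) v = (\<lambda>y. of_bool (int s = a \<and> int t = b) * v y)" for a b
  proof
    fix y
    have "xapp d (Estar d a b) v y = (\<Sum>z\<in>Xset d. if y = z then of_bool (int s = a \<and> int t = b) * v y else 0)"
      unfolding xapp_def using v by (intro sum.cong) (auto simp: Estar_def hwv_def)
    also have "\<dots> = of_bool (int s = a \<and> int t = b) * v y"
      using v by (auto simp: hwv_def)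
    finally show "xapp d (Estar d a b) v y = of_bool (int s = a \<and> int t = b) * v y" .
  qed
  moreover have "xapp d (\<lambda>y z. 0) v = (\<lambda>y. 0 * v y)" by (simp add: xapp_def)
  ultimately have "\<exists>c. xapp d (omat d m) v = (\<lambda>y. c * v y)"
    using omat_diagonal[of m d, OF diag] by metis
  then show ?case by (auto simp: cip_scale_right)
next
  case (lower i j M)
  have "cip (Xset d) v' (xapp d (xmul d (dl d i j) M) v) = 0" if "hwv d s' t' v'" for s' t' v'
  proof -
    \<comment> \<open>The adjoint of a lowering operator is a raising operator, so moving it to the
      other side of the form kills \<open>v'\<close>.\<close>
    have "(\<lambda>y z. cnj (dl d i j z y)) = dl d j i"
      by (intro ext) (simp add: dl_transpose[of d i j], simp add: dl_def onepos_def)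
    moreover have "xapp d (dl d j i) v' = (\<lambda>y. 0)" using that lower by (auto simp: hwv_def)
    ultimately show ?thesis unfolding xapp_xmul cip_xapp[of d _ "dl d i j"] by (simp add: cip_def)
  qed
  then show ?case by (intro exI[of _ 0]) simp
next
  case (upper i j M)
  have "xapp d (dl d i j) v = (\<lambda>y. 0)" using v upper by (auto simp: hwv_def)
  then show ?case by (intro exI[of _ 0]) (simp add: xapp_xmul cip_def)
qed

section \<open>Highest weight vectors from exterior powers\<close>

text \<open>The vector \<^term>\<open>blk n\<close> is the exterior product of the first \<open>n\<close> basis vectors of the
  three-dimensional space, for \<open>n = 1, 2, 3\<close>.\<close>

definition blk :: "nat \<Rightarrow> nat list \<Rightarrow> complex" where
  "blk n y = (if n = 1 then of_bool (y = [0])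
     else if n = 2 then of_bool (y = [0,1]) - of_bool (y = [1,0])
     else of_bool (y \<in> {[0,1,2], [1,2,0], [2,0,1]}) - of_bool (y \<in> {[1,0,2], [0,2,1], [2,1,0]}))"

fun bten :: "nat list \<Rightarrow> nat list \<Rightarrow> complex" where
  "bten [] y = of_bool (y = [])"
| "bten (n # ns) y = blk n (take n y) * bten ns (drop n y)"

lemma Xset_append: "y \<in> Xset n \<Longrightarrow> z \<in> Xset m \<Longrightarrow> y @ z \<in> Xset (n + m)"
  by (auto simp: Xset_def)

lemma Xset_take_drop: "y \<in> Xset (n + m) \<Longrightarrow> take n y \<in> Xset n \<and> drop n y \<in> Xset m"
  using set_take_subset[of n y] set_drop_subset[of n y] by (auto simp: Xset_def)

lemma sum_Xset_add:
  "(\<Sum>z\<in>Xset (n + m). f z) = (\<Sum>z1\<in>Xset n. \<Sum>z2\<in>Xset m. f (z1 @ z2))"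
proof -
  have "bij_betw (\<lambda>(z1, z2). z1 @ z2) (Xset n \<times> Xset m) (Xset (n + m))"
  proof (rule bij_betw_byWitness[where f' = "\<lambda>z. (take n z, drop n z)"])
    show "\<forall>q\<in>Xset n \<times> Xset m. (take n (case q of (z1, z2) \<Rightarrow> z1 @ z2), drop n (case q of (z1, z2) \<Rightarrow> z1 @ z2)) = q"
      by (auto simp: Xset_length)
    show "(\<lambda>(z1, z2). z1 @ z2) ` (Xset n \<times> Xset m) \<subseteq> Xset (n + m)" by (auto intro: Xset_append)
    show "(\<lambda>z. (take n z, drop n z)) ` Xset (n + m) \<subseteq> Xset n \<times> Xset m"
      using Xset_take_drop by blast
  qed simp
  from sum.reindex_bij_betw[OF this, of f] show ?thesis
    by (simp add: sum.cartesian_product case_prod_unfold)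
qed

lemma Xset_0 [simp]: "Xset 0 = {[]}"
  by (auto simp: Xset_def)

lemma Xset_Suc: "Xset (Suc n) = (\<lambda>(a, y). a # y) ` ({0,1,2} \<times> Xset n)"
proof (rule set_eqI)
  fix y show "y \<in> Xset (Suc n) \<longleftrightarrow> y \<in> (\<lambda>(a, y). a # y) ` ({0,1,2} \<times> Xset n)"
    by (cases y) (auto simp: Xset_def image_iff)
qed

lemma sum_Xset_Suc:
  "(\<Sum>z\<in>Xset (Suc n). f z) = (\<Sum>z\<in>Xset n. f (0 # z)) + (\<Sum>z\<in>Xset n. f (1 # z)) + (\<Sum>z\<in>Xset n. f (2 # z))"
proof -
  have "(\<Sum>z\<in>Xset (Suc n). f z) = (\<Sum>(a, y)\<in>{0,1,2} \<times> Xset n. f (a # y))"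
    unfolding Xset_Suc by (subst sum.reindex) (auto simp: inj_on_def case_prod_unfold)
  also have "\<dots> = (\<Sum>a\<in>{0,1,2}. \<Sum>y\<in>Xset n. f (a # y))" by (simp add: sum.cartesian_product)
  finally show ?thesis by (simp add: add.assoc)
qed

lemma blk_support:
  assumes "n \<in> {1,2,3}" "blk n y \<noteq> 0"
  shows "y \<in> Xset n \<and> cnt 1 y = of_bool (2 \<le> n) \<and> cnt 2 y = of_bool (3 \<le> n)"
  using assms by (auto simp: blk_def Xset_def cnt_def of_bool_def split: if_splits)

lemma bten_support:
  assumes "set ns \<subseteq> {1,2,3}" "bten ns y \<noteq> 0"
  shows "y \<in> Xset (sum_list ns) \<and> cnt 1 y = length (filter (\<lambda>n. 2 \<le> n) ns) \<and>
    cnt 2 y = length (filter (\<lambda>n. 3 \<le> n) ns)"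
  using assms
proof (induction ns arbitrary: y)
  case Nil
  then show ?case by (simp add: cnt_def of_bool_def split: if_splits)
next
  case (Cons n ns)
  let ?a = "take n y" and ?b = "drop n y"
  have a: "?a \<in> Xset n \<and> cnt 1 ?a = of_bool (2 \<le> n) \<and> cnt 2 ?a = of_bool (3 \<le> n)"
    using Cons.prems by (intro blk_support) auto
  have b: "?b \<in> Xset (sum_list ns) \<and> cnt 1 ?b = length (filter (\<lambda>n. 2 \<le> n) ns) \<and>
      cnt 2 ?b = length (filter (\<lambda>n. 3 \<le> n) ns)"
    using Cons.prems by (intro Cons.IH) auto
  have c: "cnt c y = cnt c ?a + cnt c ?b" for c
    unfolding cnt_def by (metis append_take_drop_id filter_append length_append)
  have "?a @ ?b \<in> Xset (n + sum_list ns)" using a b Xset_append by blast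
  then show ?case using a b c by simp
qed

text \<open>A form of the action of \<open>dl\<close> that reads the length off the word, so that it
  can be split along a concatenation.\<close>

definition raise :: "nat \<Rightarrow> nat \<Rightarrow> (nat list \<Rightarrow> complex) \<Rightarrow> nat list \<Rightarrow> complex" where
  "raise i j f y = (\<Sum>p<length y. if y ! p = i then f (y[p := j]) else 0)"

lemma xapp_dl:
  assumes "y \<in> Xset d" "i \<noteq> j" "j \<in> {0,1,2}"
  shows "xapp d (dl d i j) v y = raise i j v y"
proof -
  have "xapp d (dl d i j) v y = (\<Sum>p | p < d \<and> y ! p = i. v (y[p := j]))"
    unfolding xapp_def using assms by (rule sum_dl)
  also have "\<dots> = raise i j v y"
    unfolding raise_def using assms(1)
    by (intro sum.mono_neutral_cong_left) (auto simp: Xset_length)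
  finally show ?thesis .
qed

text \<open>Leibniz rule: the changed position lies either in the first or in the second tensor
  factor.\<close>

lemma raise_append:
  assumes "\<And>y1 y2. length y1 = length z1 \<Longrightarrow> length y2 = length z2 \<Longrightarrow> f (y1 @ y2) = g y1 * h y2"
  shows "raise i j f (z1 @ z2) = raise i j g z1 * h z2 + g z1 * raise i j h z2"
proof -
  have split: "(\<Sum>p<n + m. F p) = (\<Sum>p<n. F p) + (\<Sum>p<m. F (n + p))" for F :: "nat \<Rightarrow> complex" and n m :: nat
    by (induction m) (simp_all add: add.assoc)
  have "raise i j f (z1 @ z2) = (\<Sum>p<length z1. (if z1 ! p = i then g (z1[p := j]) else 0) * h z2)
      + (\<Sum>p<length z2. g z1 * (if z2 ! p = i then h (z2[p := j]) else 0))"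
    unfolding raise_def length_append split
    by (intro arg_cong2[where f = "(+)"] sum.cong) (auto simp: nth_append list_update_append assms)
  then show ?thesis by (simp add: raise_def sum_distrib_left sum_distrib_right)
qed

text \<open>Replacing the factor e_j by e_i with \<open>i < j\<close> in the exterior product of
  e_0, ..., e_(n-1) repeats a factor, and without e_j there is nothing to replace. The finitely many
  words are checked one by one.\<close>

lemma raise_blk:
  assumes "n \<in> {1,2,3}" "y \<in> Xset n" "i < j" "j \<le> 2"
  shows "raise i j (blk n) y = 0"
proof -
  have ij: "(i, j) \<in> {(0,1), (0,2), (1,2)}" using assms(3,4) by auto
  consider "n = 1" | "n = 2" | "n = 3" using assms(1) by auto
  then show ?thesis
  proof cases
    case 1
    then have "y \<in> Xset (Suc 0)" using assms by simp
    then show ?thesis using ij 1 by (auto simp: Xset_Suc raise_def blk_def)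
  next
    case 2
    then have "y \<in> Xset (Suc (Suc 0))" using assms by (simp add: numeral_2_eq_2)
    then show ?thesis using ij 2 by (auto simp: Xset_Suc raise_def blk_def)
  next
    case 3
    then have "y \<in> Xset (Suc (Suc (Suc 0)))" using assms by (simp add: numeral_3_eq_3)
    then show ?thesis using ij 3 by (auto simp: Xset_Suc raise_def blk_def)
  qed
qed

lemma raise_bten:
  assumes "set ns \<subseteq> {1,2,3}" "y \<in> Xset (sum_list ns)" "i < j" "j \<le> 2"
  shows "raise i j (bten ns) y = 0"
  using assms(1,2)
proof (induction ns arbitrary: y)
  case Nil
  then show ?case by (simp add: raise_def)
next
  case (Cons n ns)
  let ?a = "take n y" and ?b = "drop n y"
  have ab: "?a \<in> Xset n" "?b \<in> Xset (sum_list ns)" using Xset_take_drop[of y n] Cons.prems by auto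
  have "raise i j (bten (n # ns)) (?a @ ?b)
      = raise i j (blk n) ?a * bten ns ?b + blk n ?a * raise i j (bten ns) ?b"
    using Xset_length[OF ab(1)] by (intro raise_append) (simp del: length_take)
  then show ?case using raise_blk[OF _ ab(1) assms(3,4)] Cons.IH[OF _ ab(2)] Cons.prems
    by (simp del: bten.simps)
qed

lemma hwv_bten:
  assumes "set ns \<subseteq> {1,2,3}"
  shows "hwv (sum_list ns) (length (filter (\<lambda>n. 2 \<le> n) ns)) (length (filter (\<lambda>n. 3 \<le> n) ns)) (bten ns)"
  unfolding hwv_def
proof (intro conjI allI impI ext)
  fix i j y assume ij: "i < j" "j \<le> (2::nat)"
  then have j: "i \<noteq> j" "j \<in> {0,1,2}" by auto
  show "xapp (sum_list ns) (dl (sum_list ns) i j) (bten ns) y = 0"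
  proof (cases "y \<in> Xset (sum_list ns)")
    case True
    then show ?thesis using xapp_dl[OF True j] raise_bten[OF assms True ij] by simp
  next
    case False
    then show ?thesis by (rule xapp_outside[OF dl_SymMat])
  qed
qed (simp_all add: bten_support[OF assms] del: One_nat_def)

text \<open>Exhibits a nonzero coordinate, hence \<open>bten ns\<close> is not the zero
  vector.\<close>

lemma bten_leading: "set ns \<subseteq> {1,2,3} \<Longrightarrow> bten ns (concat (map (\<lambda>n. [0..<n]) ns)) = 1"
proof (induction ns)
  case (Cons n ns)
  have "blk n [0..<n] = 1" using Cons.prems by (auto simp: blk_def numeral_2_eq_2 numeral_3_eq_3)
  then show ?case using Cons by simp
qed simp

section \<open>Tensor powers of 3 by 3 matrices acting on highest weight vectors\<close>

definition tmat :: "nat \<Rightarrow> (nat \<Rightarrow> nat \<Rightarrow> complex) \<Rightarrow> xmat" where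
  "tmat d x y z = of_bool (y \<in> Xset d \<and> z \<in> Xset d) * prod_list (map (\<lambda>(a, b). x a b) (zip y z))"

lemma tmat_SymMat: "tmat d x \<in> SymMat d"
proof (rule SymMatI)
  fix \<sigma> y z assume *: "\<sigma> permutes {0..<d}" "y \<in> Xset d" "z \<in> Xset d"
  have "zip (permw d \<sigma> y) (permw d \<sigma> z) = permute_list \<sigma> (zip y z)"
    using * by (simp add: permw_eq_permute_list Xset_length permutes_atLeastLessThan permute_list_zip)
  then have "mset (map (\<lambda>(a, b). x a b) (zip (permw d \<sigma> y) (permw d \<sigma> z))) = mset (map (\<lambda>(a, b). x a b) (zip y z))"
    using * by (simp add: permutes_atLeastLessThan Xset_length)
  then have "prod_list (map (\<lambda>(a, b). x a b) (zip (permw d \<sigma> y) (permw d \<sigma> z))) = prod_list (map (\<lambda>(a, b). x a b) (zip y z))"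
    by (metis prod_mset_prod_list)
  then show "tmat d x (permw d \<sigma> y) (permw d \<sigma> z) = tmat d x y z"
    using * by (simp add: tmat_def permw_in_Xset)
qed (auto simp: tmat_def)

lemma tmat_append:
  assumes "y1 \<in> Xset n" "y2 \<in> Xset m" "z1 \<in> Xset n" "z2 \<in> Xset m"
  shows "tmat (n + m) x (y1 @ y2) (z1 @ z2) = tmat n x y1 z1 * tmat m x y2 z2"
  using assms by (simp add: tmat_def Xset_append Xset_length)

text \<open>A tensor power acts on each block separately, so a coordinate at a concatenation of
  words is the product of the coordinates of the blocks. The list \<open>ps\<close> pairs each block
  length with its word.\<close>

lemma xapp_tmat_bten:
  assumes "\<forall>(n, w)\<in>set ps. w \<in> Xset n"
  defines "d \<equiv> sum_list (map fst ps)"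
  shows "xapp d (tmat d x) (bten (map fst ps)) (concat (map snd ps))
    = prod_list (map (\<lambda>(n, w). xapp n (tmat n x) (blk n) w) ps) \<and> concat (map snd ps) \<in> Xset d"
  using assms(1) unfolding d_def
proof (induction ps)
  case Nil
  then show ?case by (simp add: xapp_def tmat_def)
next
  case (Cons q ps)
  obtain n w where q: "q = (n, w)" by (cases q)
  let ?m = "sum_list (map fst ps)" and ?y = "concat (map snd ps)"
  have w: "w \<in> Xset n" using Cons.prems q by auto
  have y: "?y \<in> Xset ?m" using Cons by auto
  have "xapp (n + ?m) (tmat (n + ?m) x) (bten (n # map fst ps)) (w @ ?y)
      = (\<Sum>z1\<in>Xset n. \<Sum>z2\<in>Xset ?m. (tmat n x w z1 * blk n z1) * (tmat ?m x ?y z2 * bten (map fst ps) z2))"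
    unfolding xapp_def sum_Xset_add using w y
    by (intro sum.cong) (auto simp: tmat_append Xset_length)
  also have "\<dots> = xapp n (tmat n x) (blk n) w * xapp ?m (tmat ?m x) (bten (map fst ps)) ?y"
    by (simp add: xapp_def sum_product)
  finally show ?case using q Cons w y by (auto intro: Xset_append simp del: bten.simps)
qed

definition lowx :: "complex \<Rightarrow> complex \<Rightarrow> complex \<Rightarrow> nat \<Rightarrow> nat \<Rightarrow> complex" where
  "lowx s t u a b = (if a = b then 1 else if a = 1 \<and> b = 0 then s else if a = 2 \<and> b = 0 then t
     else if a = 2 \<and> b = 1 then u else 0)"

text \<open>The coordinates are minors of the lower unipotent matrix formed from its first one, two
  or three columns, with rows given by the word.\<close>

lemma lowx_blk:
  shows "xapp 1 (tmat 1 (lowx s t u)) (blk 1) [0] = 1"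
    and "xapp 1 (tmat 1 (lowx s t u)) (blk 1) [1] = s"
    and "xapp 1 (tmat 1 (lowx s t u)) (blk 1) [2] = t"
    and "xapp 2 (tmat 2 (lowx s t u)) (blk 2) [0,1] = 1"
    and "xapp 2 (tmat 2 (lowx s t u)) (blk 2) [0,2] = u"
    and "xapp 2 (tmat 2 (lowx s t u)) (blk 2) [1,2] = s * u - t"
    and "xapp 3 (tmat 3 (lowx s t u)) (blk 3) [0,1,2] = 1"
  by (simp_all add: xapp_def eval_nat_numeral sum_Xset_Suc tmat_def blk_def lowx_def Xset_Suc)

section \<open>Lower bound for the dimension of a highest weight module\<close>

text \<open>A nonzero polynomial has finitely many roots, but the complement of \<open>F\<close> is
  infinite. The exceptional set makes room for dividing by a variable or cancelling a factor that
  vanishes at single points.\<close>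

lemma polyfun_cofinite_zero:
  fixes c :: "nat \<Rightarrow> complex"
  assumes "finite F" and "\<And>z. z \<notin> F \<Longrightarrow> (\<Sum>i\<le>n. c i * z ^ i) = 0" and "k \<le> n"
  shows "c k = 0"
proof (rule ccontr)
  assume "c k \<noteq> 0"
  then have "finite {z. (\<Sum>i\<le>n. c i * z ^ i) = 0}" 
    using assms(3) by (auto simp: polyfun_finite_roots)
  then have "finite (F \<union> {z. (\<Sum>i\<le>n. c i * z ^ i) = 0})" using assms(1) by blast
  moreover have "F \<union> {z. (\<Sum>i\<le>n. c i * z ^ i) = 0} = UNIV" using assms(2) by auto
  ultimately show False using infinite_UNIV_char_0[where 'a = complex] by simp
qed

text \<open>Exponents of the monomials in \<open>s\<close>, \<open>t\<close>, \<open>u\<close> and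
  \<open>w = s * u - t\<close>, of degree at most \<open>a\<close> in \<open>s\<close>,
  \<open>t\<close> and at most \<open>b\<close> in \<open>u\<close>, \<open>w\<close>. Products of
  \<open>s\<close> and \<open>u\<close> are left out because \<open>s * u = t + w\<close>. Their
  number is the Weyl dimension of the sl_3-module of highest weight (a, b).\<close>

definition Idx :: "nat \<Rightarrow> nat \<Rightarrow> (nat \<times> nat \<times> nat \<times> nat) set" where
  "Idx a b = {(i, j, k, m). i + j \<le> a \<and> k + m \<le> b \<and> (i = 0 \<or> k = 0)}"

lemma finite_Idx: "finite (Idx a b)"
  by (rule finite_subset[of _ "{..a} \<times> {..a} \<times> {..b} \<times> {..b}"]) (auto simp: Idx_def)

text \<open>With \<open>w = s u - t\<close>, the relation \<open>s u = t + w\<close> turns these monomials into Laurent polynomials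
  in \<open>s\<close> with coefficients in \<open>t\<close> and \<open>w\<close>, and the exponent of \<open>s\<close> determines both \<open>i\<close> and \<open>k\<close>.\<close>

lemma monomials_independent:
  fixes c :: "nat \<times> nat \<times> nat \<times> nat \<Rightarrow> complex"
  assumes zero: "\<And>s t u. (\<Sum>(i, j, k, m)\<in>Idx a b. c (i, j, k, m) * (s ^ i * t ^ j * u ^ k * (s * u - t) ^ m)) = 0"
    and q: "q \<in> Idx a b"
  shows "c q = 0"
proof -
  obtain i0 j0 k0 m0 where q0: "q = (i0, j0, k0, m0)" by (cases q) auto
  have le: "i0 + j0 \<le> a" "k0 + m0 \<le> b" "i0 = 0 \<or> k0 = 0" using q q0 by (auto simp: Idx_def)
  \<comment> \<open>Substituting \<open>u = (t + w) / s\<close> gives s the exponent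
    \<open>i - k\<close>; multiplication by \<open>s ^ b\<close> makes it a natural number, since
    \<open>k \<le> b\<close>.\<close>
  define h where "h = (\<lambda>(i, j::nat, k, m::nat). b + i - k)"
  define f where "f t w = (\<lambda>(i::nat, j, k, m). c (i, j, k, m) * (t ^ j * (t + w) ^ k * w ^ m))" for t w
  define g where "g t w e = (\<Sum>q | q \<in> Idx a b \<and> h q = e. f t w q)" for t w e
  have "(\<Sum>e\<le>a + b. g t w e * s ^ e) = 0" if s: "s \<notin> {0}" for s t w
  proof -
    have "(\<Sum>e\<le>a + b. g t w e * s ^ e) = (\<Sum>e\<le>a + b. \<Sum>q | q \<in> Idx a b \<and> h q = e. f t w q * s ^ h q)"
      by (simp add: g_def sum_distrib_right)
    also have "\<dots> = (\<Sum>q\<in>Idx a b. f t w q * s ^ h q)"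
      by (rule sum.group) (auto simp: finite_Idx, auto simp: Idx_def h_def)
    also have "\<dots> = (\<Sum>(i, j, k, m)\<in>Idx a b. s ^ b * (c (i, j, k, m) *
        (s ^ i * t ^ j * ((t + w) / s) ^ k * (s * ((t + w) / s) - t) ^ m)))"
    proof (rule sum.cong[OF refl])
      fix q assume "q \<in> Idx a b"
      then obtain i j k m where *: "q = (i, j, k, m)" "k \<le> b" by (cases q) (auto simp: Idx_def)
      have "s ^ (b + i - k) * s ^ k = s ^ b * s ^ i" using * by (simp flip: power_add)
      then have "s ^ (b + i - k) = s ^ b * s ^ i / s ^ k" using s by (simp add: field_simps)
      then show "f t w q * s ^ h q = (case q of (i, j, k, m) \<Rightarrow> s ^ b * (c (i, j, k, m) *
          (s ^ i * t ^ j * ((t + w) / s) ^ k * (s * ((t + w) / s) - t) ^ m)))"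
        using s * by (simp add: f_def h_def power_divide)
    qed
    also have "\<dots> = s ^ b * (\<Sum>(i, j, k, m)\<in>Idx a b. c (i, j, k, m) *
        (s ^ i * t ^ j * ((t + w) / s) ^ k * (s * ((t + w) / s) - t) ^ m))"
      by (simp add: sum_distrib_left case_prod_unfold)
    finally show ?thesis by (simp only: zero mult_zero_right)
  qed
  then have g0: "g t w (b + i0 - k0) = 0" for t w
    using le by (intro polyfun_cofinite_zero[where F = "{0}" and n = "a + b" and c = "g t w"]) auto
  have set: "{q. q \<in> Idx a b \<and> h q = b + i0 - k0} = (\<lambda>(j, m). (i0, j, k0, m)) ` ({..a - i0} \<times> {..b - k0})"
    (is "?L = ?R")
  proof
    show "?R \<subseteq> ?L" using le by (auto simp: Idx_def h_def)
    show "?L \<subseteq> ?R"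
    proof
      fix q assume "q \<in> ?L"
      then obtain i j k m where *: "q = (i, j, k, m)" "i + j \<le> a" "k + m \<le> b" "i = 0 \<or> k = 0"
        "b + i - k = b + i0 - k0" by (cases q) (auto simp: Idx_def h_def)
      then have "i = i0" "k = k0" using le by auto
      then show "q \<in> ?R" using * by (auto simp: image_iff)
    qed
  qed
  have g: "g t w (b + i0 - k0) = (t + w) ^ k0 * (\<Sum>m\<le>b - k0. (\<Sum>j\<le>a - i0. c (i0, j, k0, m) * t ^ j) * w ^ m)" for t w
  proof -
    have "g t w (b + i0 - k0) = (\<Sum>(j, m)\<in>{..a - i0} \<times> {..b - k0}. f t w (i0, j, k0, m))"
      unfolding g_def set by (subst sum.reindex) (auto simp: inj_on_def case_prod_unfold)
    also have "\<dots> = (\<Sum>j\<le>a - i0. \<Sum>m\<le>b - k0. f t w (i0, j, k0, m))"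
      by (simp add: sum.cartesian_product)
    also have "\<dots> = (\<Sum>m\<le>b - k0. \<Sum>j\<le>a - i0. f t w (i0, j, k0, m))" by (rule sum.swap)
    finally show ?thesis by (simp add: f_def sum_distrib_left sum_distrib_right mult_ac)
  qed
  \<comment> \<open>The common factor \<open>(t + w) ^ k0\<close> can be cancelled away from
    \<open>w = - t\<close>; coefficients are then compared in \<open>w\<close> and afterwards in
    \<open>t\<close>.\<close>
  have "(\<Sum>j\<le>a - i0. c (i0, j, k0, m0) * t ^ j) = 0" for t
  proof (rule polyfun_cofinite_zero[where F = "{- t}" and n = "b - k0" and c = "\<lambda>m. \<Sum>j\<le>a - i0. c (i0, j, k0, m) * t ^ j"])
    fix w assume "w \<notin> {- t}"
    then have "t + w \<noteq> 0" by (auto simp: add_eq_0_iff)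
    then show "(\<Sum>m\<le>b - k0. (\<Sum>j\<le>a - i0. c (i0, j, k0, m) * t ^ j) * w ^ m) = 0"
      using g[of t w] g0[of t w] by simp
  qed (use le in auto)
  then have "c (i0, j0, k0, m0) = 0"
    using le by (intro polyfun_cofinite_zero[where F = "{}" and n = "a - i0" and c = "\<lambda>j. c (i0, j, k0, m0)"]) auto
  then show ?thesis using q0 by simp
qed

lemma card_triangle: "2 * card {(i, j). i + j \<le> (a::nat)} = (a + 1) * (a + 2)"
proof -
  have "{(i, j). i + j \<le> a} = Sigma {..a} (\<lambda>i. {..a - i})" by auto
  then have "card {(i, j). i + j \<le> a} = (\<Sum>i\<le>a. Suc (a - i))" by simp
  also have "\<dots> = (\<Sum>i\<le>a. Suc i)"
    by (rule sum.reindex_bij_witness[of _ "\<lambda>i. a - i" "\<lambda>i. a - i"]) auto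
  also have "2 * \<dots> = (a + 1) * (a + 2)" by (induction a) auto
  finally show ?thesis .
qed

lemma card_Idx: "card (Idx a b) = ((a + 1) * (b + 1) * (a + b + 2)) div 2"
proof -
  let ?T = "\<lambda>a. {(i, j). i + j \<le> (a::nat)}"
  \<comment> \<open>Inclusion-exclusion: \<open>A\<close> is the part with \<open>k = 0\<close>,
    \<open>B\<close> the part with \<open>i = 0\<close>, and \<open>C\<close> is their
    intersection.\<close>
  define A :: "(nat \<times> nat \<times> nat \<times> nat) set" where "A = (\<lambda>((i, j), m). (i, j, 0, m)) ` (?T a \<times> {..b})"
  define B :: "(nat \<times> nat \<times> nat \<times> nat) set" where "B = (\<lambda>((k, m), j). (0, j, k, m)) ` (?T b \<times> {..a})"
  define C :: "(nat \<times> nat \<times> nat \<times> nat) set" where "C = (\<lambda>(j, m). (0, j, 0, m)) ` ({..a} \<times> {..b})"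
  have fin: "finite (?T a)" for a
    by (rule finite_subset[of _ "{..a} \<times> {..a}"]) auto
  have "Idx a b = A \<union> B" by (auto simp: A_def B_def Idx_def image_iff)
  moreover have "A \<inter> B = C" by (auto simp: A_def B_def C_def image_iff)
  ultimately have "card A + card B = card (Idx a b) + card C"
    using card_Un_Int[of A B] fin by (simp add: A_def B_def)
  moreover have "card A = card (?T a) * (b + 1)"
    unfolding A_def by (subst card_image) (auto simp: inj_on_def card_cartesian_product)
  moreover have "card B = card (?T b) * (a + 1)"
    unfolding B_def by (subst card_image) (auto simp: inj_on_def card_cartesian_product)
  moreover have "card C = (a + 1) * (b + 1)"
    unfolding C_def by (subst card_image) (auto simp: inj_on_def card_cartesian_product)
  ultimately have "2 * card (Idx a b) + 2 * ((a + 1) * (b + 1))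
      = (2 * card (?T a)) * (b + 1) + (2 * card (?T b)) * (a + 1)" by (simp add: algebra_simps)
  then have "2 * card (Idx a b) = (a + 1) * (b + 1) * (a + b + 2)"
    unfolding card_triangle by (simp add: algebra_simps)
  then show ?thesis by simp
qed

text \<open>The column lengths of a Young diagram with at most three rows, in increasing
  order.\<close>

definition hwblocks :: "nat \<Rightarrow> nat \<Rightarrow> nat \<Rightarrow> nat list" where
  "hwblocks a b l = replicate a 1 @ replicate b 2 @ replicate l 3"

text \<open>With fewer spanning vectors than \<open>card (Idx a b)\<close>, some nontrivial
  combination of the coordinates at the words \<open>word q\<close> vanishes on the whole module. On
  the translates by \<open>tmat d (lowx s t w)\<close> it becomes a vanishing combination of
  independent monomials.\<close>

lemma hw_module_dim_ge:
  fixes n :: nat and u :: "nat \<Rightarrow> nat list \<Rightarrow> complex"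
  assumes d: "d = a + 2 * b + 3 * l"
    and span: "\<And>M. M \<in> SymMat d \<Longrightarrow> \<exists>e. \<forall>x. xapp d M (bten (hwblocks a b l)) x = (\<Sum>i<n. e i * u i x)"
  shows "card (Idx a b) \<le> n"
proof (rule ccontr)
  assume "\<not> card (Idx a b) \<le> n"
  then have n: "card {..<n} < card (Idx a b)" by simp
  \<comment> \<open>By \<open>lowx_blk\<close>, the \<open>i\<close>, \<open>j\<close>,
    \<open>k\<close> and \<open>m\<close> blocks contribute the factors s, t, u and s u - t (u is
    called \<open>w\<close> below), and all remaining blocks contribute 1.\<close>
  define ps where "ps = (\<lambda>(i, j, k, m). replicate (a - i - j) (1::nat, [0::nat]) @ replicate i (1, [1]) @
    replicate j (1, [2]) @ replicate (b - k - m) (2, [0,1]) @ replicate k (2, [0,2]) @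
    replicate m (2, [1,2]) @ replicate l (3, [0,1,2]))"
  define word where "word q = concat (map snd (ps q))" for q
  obtain c where c: "\<exists>q\<in>Idx a b. c q \<noteq> 0" "\<forall>i\<in>{..<n}. (\<Sum>q\<in>Idx a b. c q * u i (word q)) = 0"
    using linear_dependence[OF _ finite_Idx n, of "\<lambda>q i. u i (word q)"] by auto
  have val: "xapp d (tmat d (lowx s t w)) (bten (hwblocks a b l)) (word q)
      = (case q of (i, j, k, m) \<Rightarrow> s ^ i * t ^ j * w ^ k * (s * w - t) ^ m)" if q_in: "q \<in> Idx a b" for q s t w
  proof -
    obtain i j k m where q: "q = (i, j, k, m)" "i + j \<le> a" "k + m \<le> b"
      using q_in by (cases q) (auto simp: Idx_def)
    have "replicate a (1::nat) = replicate ((a - i - j) + i + j) 1" "replicate b (2::nat) = replicate ((b - k - m) + k + m) 2"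
      using q by simp_all
    then have fst: "map fst (ps q) = hwblocks a b l"
      unfolding replicate_add by (simp add: ps_def hwblocks_def q)
    have sum: "sum_list (hwblocks a b l) = d"
      unfolding hwblocks_def d by (simp add: sum_list_replicate)
    have "\<forall>(n, w)\<in>set (ps q). w \<in> Xset n" by (auto simp: ps_def q Xset_def)
    from xapp_tmat_bten[OF this, of "lowx s t w"] show ?thesis
      unfolding fst sum word_def[symmetric]
      by (simp add: ps_def q lowx_blk lowx_blk[simplified] mult_ac)
  qed
  have "(\<Sum>(i, j, k, m)\<in>Idx a b. c (i, j, k, m) * (s ^ i * t ^ j * w ^ k * (s * w - t) ^ m)) = 0" for s t w
  proof -
    obtain e where e: "\<forall>x. xapp d (tmat d (lowx s t w)) (bten (hwblocks a b l)) x = (\<Sum>i<n. e i * u i x)"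
      using span[OF tmat_SymMat] by blast
    have "(\<Sum>(i, j, k, m)\<in>Idx a b. c (i, j, k, m) * (s ^ i * t ^ j * w ^ k * (s * w - t) ^ m))
        = (\<Sum>q\<in>Idx a b. c q * xapp d (tmat d (lowx s t w)) (bten (hwblocks a b l)) (word q))"
      by (intro sum.cong) (auto simp: val)
    also have "\<dots> = (\<Sum>q\<in>Idx a b. \<Sum>i<n. e i * (c q * u i (word q)))"
      unfolding e[rule_format] by (simp add: sum_distrib_left mult_ac)
    also have "\<dots> = (\<Sum>i<n. e i * (\<Sum>q\<in>Idx a b. c q * u i (word q)))"
      by (subst sum.swap) (simp add: sum_distrib_left)
    also have "\<dots> = 0" using c(2) by simp
    finally show ?thesis .
  qed
  then show False using monomials_independent[where c = c and a = a and b = b] c(1) by blast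
qed

section \<open>Counting\<close>

text \<open>Stars and bars: a type is determined by the multiplicities of the nine pairs of letters,
  which add up to \<open>d\<close>.\<close>

lemma card_pairtypes_le: "card (pairtypes d) \<le> (d + 8) choose d"
proof -
  define qs where "qs = List.product [0,1,2::nat] [0,1,2::nat]"
  have qs: "distinct qs" "length qs = 9" "set qs = {0,1,2} \<times> {0,1,2}"
    by (simp_all add: qs_def distinct_product)
  have sub: "set_mset m \<subseteq> set qs" "size m = d" if m: "m \<in> pairtypes d" for m
  proof -
    obtain y z where "y \<in> Xset d" "z \<in> Xset d" "m = mset (zip y z)"
      using m by (auto simp: pairtypes_def)
    note yz = this
    show "size m = d" using yz by (simp add: Xset_length)
    show "set_mset m \<subseteq> set qs"
    proof
      fix q assume "q \<in># m"
      then have "(fst q, snd q) \<in> set (zip y z)" using yz by simp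
      then have "fst q \<in> set y" "snd q \<in> set z" by (rule set_zip_leftD, rule set_zip_rightD)
      then have "fst q \<in> {0,1,2}" "snd q \<in> {0,1,2}" using yz unfolding Xset_def by blast+
      then show "q \<in> set qs" unfolding qs(3) by (cases q) (simp only: fst_conv snd_conv mem_Sigma_iff)
    qed
  qed
  let ?f = "\<lambda>m. map (count m) qs"
  have "inj_on ?f (pairtypes d)"
  proof (rule inj_onI)
    fix m m' assume *: "m \<in> pairtypes d" "m' \<in> pairtypes d" "?f m = ?f m'"
    show "m = m'"
    proof (rule multiset_eqI)
      fix q show "count m q = count m' q"
      proof (cases "q \<in> set qs")
        case False
        then have "q \<notin># m" "q \<notin># m'" using sub * by blast+
        then show ?thesis by (simp add: not_in_iff)
      qed (use * in simp)
    qed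
  qed
  moreover have "?f ` pairtypes d \<subseteq> {l. length l = 9 \<and> sum_list l = d}"
  proof safe
    fix m assume m: "m \<in> pairtypes d"
    have "sum_list (?f m) = (\<Sum>q\<in>set qs. count m q)" using qs(1) by (simp add: sum_list_distinct_conv_sum_set)
    also have "\<dots> = (\<Sum>q\<in>set_mset m. count m q)"
      using sub(1)[OF m] by (intro sum.mono_neutral_right) (auto simp: not_in_iff)
    also have "\<dots> = d" using sub(2)[OF m] by (simp add: size_multiset_overloaded_eq)
    finally show "sum_list (?f m) = d" .
  qed (simp add: qs)
  moreover have "card {l::nat list. length l = 9 \<and> sum_list l = d} = (d + 8) choose d"
    using card_length_sum_list[of 9 d] by (simp add: add.commute)
  moreover have "finite {l::nat list. length l = 9 \<and> sum_list l = d}"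
    by (rule finite_subset[OF _ finite_lists_length_eq[of "{..d}" 9]]) (auto dest: member_le_sum_list)
  ultimately show ?thesis
    using card_inj_on_le[of ?f "pairtypes d" "{l. length l = 9 \<and> sum_list l = d}"] by (simp only:)
qed

lemma nsize_eq_card_Idx:
  assumes "(l, m) \<in> blocks d"
  shows "nsize d (l, m) = card (Idx (d - 3 * l - 2 * m) m)"
proof -
  have "2 * m \<le> d - 3 * l" using assms by (auto simp: blocks_def)
  then have "d - 3 * l - m + 2 = (d - 3 * l - 2 * m) + m + 2" by simp
  then show ?thesis by (simp add: nsize_def card_Idx)
qed

text \<open>The polynomial comes from expanding the summand of \<open>sum_sq_eq_sqpoly\<close> in powers of \<open>m\<close> and applying
  Faulhaber's formulas; at \<open>k = e div 2 + 1\<close> its value no longer depends on the parity of \<open>e\<close>.\<close>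

definition sqpoly :: "real \<Rightarrow> real \<Rightarrow> real" where
  "sqpoly k x = k * (2036 + 3234 * x + 1799 * x ^ 2 + 420 * x ^ 3 + 35 * x ^ 4 + k * (630 + 3045 * x
    + 2835 * x ^ 2 + 945 * x ^ 3 + 105 * x ^ 4 + k * (- 3290 - 3990 * x - 980 * x ^ 2 + 210 * x ^ 3
    + 70 * x ^ 4 + k * (630 - 1365 * x - 1470 * x ^ 2 - 315 * x ^ 3 + k * (1554 + 2016 * x
    + 546 * x ^ 2 + k * (- 840 - 420 * x + k * 120))))))"

lemma sqpoly_step:
  "sqpoly k x + 210 * ((x - 2 * k + 1) * (k + 1) * (x - k + 2))\<^sup>2 = sqpoly (k + 1) x"
  unfolding sqpoly_def by algebra

lemma sum_sq_eq_sqpoly: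
  "210 * (\<Sum>m<k. ((x - 2 * real m + 1) * (real m + 1) * (x - real m + 2))\<^sup>2) = sqpoly (real k) x"
proof (induction k)
  case 0
  then show ?case by (simp add: sqpoly_def)
next
  case (Suc k)
  then show ?case using sqpoly_step[of "real k" x] by (simp add: distrib_left add.commute)
qed

text \<open>Each parity of the summation range becomes a polynomial identity in \<open>k\<close>.
  The right-hand side is 8! times the difference of the binomial coefficients of e + 11 and e + 8
  over 8.\<close>

lemma sqpoly_closed:
  assumes "2 * k = e + 5 \<or> 2 * k = e + 4"
  shows "48 * sqpoly k (e + 3) = (e + 4) * (e + 5) * (e + 6) * (e + 7) * (e + 8) * (e + 9) * (e + 10) * (e + 11)
    - (e + 1) * (e + 2) * (e + 3) * (e + 4) * (e + 5) * (e + 6) * (e + 7) * (e + 8)"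
proof -
  from assms consider "e = 2 * k - 5" | "e = 2 * k - 4" by auto
  then show ?thesis
  proof cases
    case 1
    show ?thesis unfolding 1 sqpoly_def by algebra
  next
    case 2
    show ?thesis unfolding 2 sqpoly_def by algebra
  qed
qed

text \<open>The contribution of all blocks with a fixed \<open>l\<close>, where
  \<open>e = d - 3 * l\<close>.\<close>

definition sqsum :: "nat \<Rightarrow> nat" where
  "sqsum e = (\<Sum>m\<le>e div 2. (card (Idx (e - 2 * m) m))\<^sup>2)"

text \<open>The factor is 840 = 4 * 210: the 4 clears the squared halves of the dimension formula,
  and 210 is the normalisation of \<open>sqpoly\<close>.\<close>

lemma sqsum_eq_sqpoly: "840 * real (sqsum e) = sqpoly (real (e div 2) + 1) (real e)"
proof -
  have two: "2 * card (Idx a b) = (a + 1) * (b + 1) * (a + b + 2)" for a b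
  proof -
    have "even ((a + 1) * (b + 1) * (a + b + 2))" by auto
    then show ?thesis unfolding card_Idx by simp
  qed
  have "4 * real (sqsum e) = (\<Sum>m\<le>e div 2. (real (2 * card (Idx (e - 2 * m) m)))\<^sup>2)"
    by (simp add: sqsum_def sum_distrib_left power_mult_distrib)
  also have "\<dots> = (\<Sum>m\<le>e div 2. ((real e - 2 * real m + 1) * (real m + 1) * (real e - real m + 2))\<^sup>2)"
  proof (rule sum.cong[OF refl])
    fix m assume "m \<in> {..e div 2}"
    then have "2 * m \<le> e" by simp
    then have "real (e - 2 * m) = real e - 2 * real m" by (simp add: of_nat_diff)
    then have "real (2 * card (Idx (e - 2 * m) m)) = (real e - 2 * real m + 1) * (real m + 1) * (real e - real m + 2)"
      unfolding two of_nat_mult of_nat_add of_nat_numeral of_nat_1 by simp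
    then show "(real (2 * card (Idx (e - 2 * m) m)))\<^sup>2
        = ((real e - 2 * real m + 1) * (real m + 1) * (real e - real m + 2))\<^sup>2"
      by (simp only:)
  qed
  finally have "840 * real (sqsum e) = 210 * (\<Sum>m<Suc (e div 2). ((real e - 2 * real m + 1) * (real m + 1) * (real e - real m + 2))\<^sup>2)"
    by (simp add: lessThan_Suc_atMost)
  then show ?thesis unfolding sum_sq_eq_sqpoly by (simp add: add.commute)
qed

lemma choose_8: "40320 * real ((n + 8) choose n) = (real n + 1) * (real n + 2) * (real n + 3) * (real n + 4)
    * (real n + 5) * (real n + 6) * (real n + 7) * (real n + 8)"
proof -
  have "real ((n + 8) choose n) = fact (n + 8) / (fact n * fact 8)"
    using binomial_fact[of n "n + 8", where 'a = real] by simp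
  moreover have "(fact (n + 8) :: real) = fact n * ((real n + 1) * (real n + 2) * (real n + 3) * (real n + 4)
      * (real n + 5) * (real n + 6) * (real n + 7) * (real n + 8))"
    by (simp add: eval_nat_numeral algebra_simps)
  moreover have "(fact 8 :: real) = 40320" by (simp add: eval_nat_numeral)
  ultimately show ?thesis by simp
qed

text \<open>This makes the sum over \<open>l\<close> telescope in steps of three. All terms are
  compared after multiplication by 8! = 40320 = 48 * 840.\<close>

lemma sqsum_step: "sqsum (e + 3) + ((e + 8) choose e) = (e + 11) choose (e + 3)"
proof -
  have p: "48 * sqpoly (real ((e + 3) div 2) + 1) (real (e + 3)) =
     (real e + 4) * (real e + 5) * (real e + 6) * (real e + 7) * (real e + 8) * (real e + 9) * (real e + 10) * (real e + 11)
     - (real e + 1) * (real e + 2) * (real e + 3) * (real e + 4) * (real e + 5) * (real e + 6) * (real e + 7) * (real e + 8)"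
  proof -
    have "2 * ((e + 3) div 2 + 1) = e + 5 \<or> 2 * ((e + 3) div 2 + 1) = e + 4" by presburger
    then have "real (2 * ((e + 3) div 2 + 1)) = real (e + 5) \<or> real (2 * ((e + 3) div 2 + 1)) = real (e + 4)"
      by (simp only: of_nat_eq_iff)
    then have "2 * (real ((e + 3) div 2) + 1) = real e + 5 \<or> 2 * (real ((e + 3) div 2) + 1) = real e + 4"
      by (simp only: of_nat_mult of_nat_add of_nat_numeral of_nat_1)
    from sqpoly_closed[OF this] show ?thesis by (simp only: of_nat_add of_nat_numeral)
  qed
  have "40320 * real (sqsum (e + 3)) = 48 * (840 * real (sqsum (e + 3)))" by simp
  also note sqsum_eq_sqpoly
  also note p
  finally have a: "40320 * real (sqsum (e + 3)) =
     (real e + 4) * (real e + 5) * (real e + 6) * (real e + 7) * (real e + 8) * (real e + 9) * (real e + 10) * (real e + 11)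
     - 40320 * real ((e + 8) choose e)" by (simp only: choose_8)
  have "40320 * real ((e + 11) choose (e + 3)) =
     (real e + 4) * (real e + 5) * (real e + 6) * (real e + 7) * (real e + 8) * (real e + 9) * (real e + 10) * (real e + 11)"
  proof -
    have *: "e + 3 + 8 = e + 11" "\<And>c. real (e + 3) + c = real e + (3 + c)" by simp_all
    show ?thesis using choose_8[of "e + 3"] unfolding * by (simp only: numeral_plus_one arith_simps add_numeral_special)
  qed
  then have "40320 * real (sqsum (e + 3)) + 40320 * real ((e + 8) choose e) = 40320 * real ((e + 11) choose (e + 3))"
    by (simp only: a diff_add_cancel)
  then have "40320 * real (sqsum (e + 3) + ((e + 8) choose e)) = 40320 * real ((e + 11) choose (e + 3))"
    by (simp only: of_nat_add distrib_left)
  then have "real (sqsum (e + 3) + ((e + 8) choose e)) = real ((e + 11) choose (e + 3))"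
    by (simp only: mult_cancel_left) simp
  then show ?thesis by (simp only: of_nat_eq_iff)
qed

text \<open>Grouped by \<open>l\<close>, the sum is that of \<open>sqsum\<close> at d, d - 3, d - 6
  and so on, and telescopes by \<open>sqsum_step\<close>; the cases below 3 are evaluated.\<close>

theorem sum_nsize_squares: "(\<Sum>p\<in>blocks d. (nsize d p)\<^sup>2) = (d + 8) choose d"
proof -
  have Sig: "blocks d = Sigma {..d div 3} (\<lambda>l. {..(d - 3 * l) div 2})" by (auto simp: blocks_def)
  have "(\<Sum>p\<in>blocks d. (nsize d p)\<^sup>2) = (\<Sum>l\<le>d div 3. \<Sum>m\<le>(d - 3 * l) div 2. (nsize d (l, m))\<^sup>2)"
    unfolding Sig by (simp add: sum.Sigma)
  also have "\<dots> = (\<Sum>l\<le>d div 3. sqsum (d - 3 * l))"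
    unfolding sqsum_def by (intro sum.cong) (auto simp: nsize_eq_card_Idx blocks_def)
  also have "\<dots> = (d + 8) choose d"
  proof (induction d rule: less_induct)
    case (less d)
    show ?case
    proof (cases "d < 3")
      case True
      from True consider "d = 0" | "d = 1" | "d = 2" by linarith
      then show ?thesis
        by cases (simp_all add: sqsum_def card_Idx choose_two power2_eq_square)
    next
      case False
      then obtain e where e: "d = e + 3" by (metis add.commute le_Suc_ex not_less)
      have "(\<Sum>l\<le>d div 3. sqsum (d - 3 * l)) = sqsum (e + 3) + (\<Sum>l\<le>e div 3. sqsum (e - 3 * l))"
      proof -
        have "d div 3 = Suc (e div 3)" using e by simp
        then show ?thesis using e by (simp add: sum.atMost_Suc_shift del: sum.atMost_Suc)
      qed
      also have "\<dots> = d + 8 choose d" using less[of e] sqsum_step[of e] e by (simp add: add.commute[of 11])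
      finally show ?thesis .
    qed
  qed
  finally show ?thesis .
qed

section \<open>Matrix units\<close>

lemma hwv_scale: "hwv d s t v \<Longrightarrow> hwv d s t (\<lambda>y. c * v y)"
  by (auto simp: hwv_def xapp_scale)

lemma xapp_add: "xapp d M (\<lambda>y. v y + w y) = (\<lambda>y. xapp d M v y + xapp d M w y)"
  by (simp add: xapp_def distrib_left sum.distrib)

lemma xapp_sum: "xapp d M (\<lambda>y. \<Sum>i\<in>I. f i y) = (\<lambda>y. \<Sum>i\<in>I. xapp d M (f i) y)"
  unfolding xapp_def by (intro ext) (simp add: sum_distrib_left, rule sum.swap)

lemma hwv_add:
  assumes "hwv d s t v" "hwv d s t w"
  shows "hwv d s t (\<lambda>y. v y + w y)"
proof -
  have "v y \<noteq> 0 \<or> w y \<noteq> 0" if "v y + w y \<noteq> 0" for y using that by auto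
  then show ?thesis using assms unfolding hwv_def xapp_add by simp blast
qed

lemma hwv_sum:
  assumes "hwv d s t w" "finite I" "\<And>i. i \<in> I \<Longrightarrow> hwv d s t (f i)"
  shows "hwv d s t (\<lambda>y. \<Sum>i\<in>I. f i y)"
  using assms(2,3)
proof (induction I rule: finite_induct)
  case empty
  then show ?case using hwv_scale[OF assms(1), of 0] by simp
next
  case (insert i I)
  then show ?case using hwv_add[of d s t "f i" "\<lambda>y. \<Sum>i\<in>I. f i y"] by simp
qed

section \<open>Averaging over the symmetric group\<close>

definition permv :: "nat \<Rightarrow> (nat \<Rightarrow> nat) \<Rightarrow> (nat list \<Rightarrow> complex) \<Rightarrow> nat list \<Rightarrow> complex" where
  "permv d \<sigma> v y = of_bool (y \<in> Xset d) * v (permw d \<sigma> y)"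

lemma hwv_permv:
  assumes v: "hwv d s t v" and \<sigma>: "\<sigma> permutes {0..<d}"
  shows "hwv d s t (permv d \<sigma> v)"
  unfolding hwv_def
proof (intro conjI allI impI ext)
  fix y assume "permv d \<sigma> v y \<noteq> 0"
  then have y: "y \<in> Xset d" "v (permw d \<sigma> y) \<noteq> 0" by (auto simp: permv_def)
  then show "y \<in> Xset d" by blast
  have "cnt a (permw d \<sigma> y) = cnt a y" for a
    using mset_permw[OF \<sigma> Xset_length[OF y(1)]] by (simp add: cnt_eq_count)
  then show "cnt 1 y = s" "cnt 2 y = t" using v y(2) by (auto simp: hwv_def)
next
  fix i j y assume ij: "i < j" "j \<le> (2::nat)"
  show "xapp d (dl d i j) (permv d \<sigma> v) y = 0"
  proof (cases "y \<in> Xset d")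
    case True
    have "xapp d (dl d i j) (permv d \<sigma> v) y
        = (\<Sum>z\<in>Xset d. dl d i j (permw d \<sigma> y) (permw d \<sigma> z) * v (permw d \<sigma> z))"
      unfolding xapp_def using SymMat_permw[OF dl_SymMat \<sigma> True]
      by (intro sum.cong) (auto simp: permv_def)
    also have "\<dots> = xapp d (dl d i j) v (permw d \<sigma> y)"
      unfolding xapp_def by (rule sum_Xset_permw[OF \<sigma>])
    also have "\<dots> = 0" using v ij by (simp add: hwv_def)
    finally show ?thesis .
  qed (rule xapp_outside[OF dl_SymMat])
qed

text \<open>The rank-one matrix of \<open>v\<close> summed over all translates of \<open>v\<close>,
  that is, d! times its average over the symmetric group.\<close>

definition Qmat :: "nat \<Rightarrow> (nat list \<Rightarrow> complex) \<Rightarrow> xmat" where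
  "Qmat d v y z = (\<Sum>\<sigma> | \<sigma> permutes {0..<d}. permv d \<sigma> v y * cnj (permv d \<sigma> v z))"

lemma Qmat_SymMat: "Qmat d v \<in> SymMat d"
proof (rule SymMatI)
  fix \<tau> y z assume *: "\<tau> permutes {0..<d}" "y \<in> Xset d" "z \<in> Xset d"
  have "Qmat d v (permw d \<tau> y) (permw d \<tau> z)
      = (\<Sum>\<sigma> | \<sigma> permutes {0..<d}. permv d (\<tau> \<circ> \<sigma>) v y * cnj (permv d (\<tau> \<circ> \<sigma>) v z))"
    unfolding Qmat_def using * by (intro sum.cong) (auto simp: permv_def permw_compose permw_in_Xset)
  also have "\<dots> = Qmat d v y z"
    unfolding Qmat_def by (rule setum_permutations_compose_left[OF *(1), symmetric])
  finally show "Qmat d v (permw d \<tau> y) (permw d \<tau> z) = Qmat d v y z" .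
qed (auto simp: Qmat_def permv_def)

lemma xapp_Qmat:
  "xapp d (Qmat d v) w y = (\<Sum>\<sigma> | \<sigma> permutes {0..<d}. cip (Xset d) (permv d \<sigma> v) w * permv d \<sigma> v y)"
proof -
  have "xapp d (Qmat d v) w y
      = (\<Sum>z\<in>Xset d. \<Sum>\<sigma> | \<sigma> permutes {0..<d}. permv d \<sigma> v y * cnj (permv d \<sigma> v z) * w z)"
    by (simp add: xapp_def Qmat_def sum_distrib_right)
  also have "\<dots> = (\<Sum>\<sigma> | \<sigma> permutes {0..<d}. \<Sum>z\<in>Xset d. permv d \<sigma> v y * cnj (permv d \<sigma> v z) * w z)"
    by (rule sum.swap)
  finally show ?thesis by (simp add: cip_def sum_distrib_left mult_ac)
qed

text \<open>\<open>Qmat d v\<close> maps into the span of the translates of \<open>v\<close>, which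
  are highest weight vectors of the same weight. By \<open>SymMat_hwv_scalar\<close> the element
  \<open>M\<close> enters each pairing with them only through one scalar, so \<open>Qmat d v\<close>
  sends \<open>xapp d M v\<close> to a multiple of its value at \<open>v\<close>.\<close>

lemma hw_projector:
  assumes v: "hwv d s t v" and nz: "cip (Xset d) v v \<noteq> 0"
  shows "\<exists>Q\<in>SymMat d. (\<forall>M\<in>SymMat d. xapp d Q (xapp d M v) = (\<lambda>y. cip (Xset d) v (xapp d M v) * v y)) \<and>
    (\<forall>s' t' v' M. hwv d s' t' v' \<longrightarrow> (s', t') \<noteq> (s, t) \<longrightarrow> M \<in> SymMat d \<longrightarrow> xapp d Q (xapp d M v') = (\<lambda>y. 0))"
proof -
  let ?X = "Xset d" and ?S = "{\<sigma>. \<sigma> permutes {0..<d}}" and ?Q = "Qmat d v"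
  have fin: "finite ?S" by (simp add: finite_permutations)
  have hw\<sigma>: "hwv d s t (permv d \<sigma> v)" if "\<sigma> \<in> ?S" for \<sigma> using hwv_permv[OF v] that by simp
  have Qv: "xapp d ?Q v = (\<lambda>y. \<Sum>\<sigma>\<in>?S. cip ?X (permv d \<sigma> v) v * permv d \<sigma> v y)"
    by (intro ext xapp_Qmat)
  obtain k where k: "\<forall>s' t' v'. hwv d s' t' v' \<longrightarrow> cip ?X v' (xapp d ?Q v) = k * cip ?X v' v"
    using SymMat_hwv_scalar[OF Qmat_SymMat v] by blast
  have hwQv: "hwv d s t (xapp d ?Q v)"
    unfolding Qv by (rule hwv_sum[OF v fin]) (intro hwv_scale hw\<sigma>)
  \<comment> \<open>The difference of \<open>xapp d ?Q v\<close> and \<open>k\<close> times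
    \<open>v\<close> is itself a highest weight vector and pairs to zero with all of them, in
    particular with itself.\<close>
  have Qv_eq: "xapp d ?Q v y = k * v y" for y
  proof -
    let ?r = "\<lambda>y. xapp d ?Q v y + (- k) * v y"
    have r: "hwv d s t ?r" by (intro hwv_add hwQv hwv_scale v)
    have "cip ?X ?r ?r = 0"
      unfolding cip_add_right[of _ ?r] cip_scale_right using k r by simp
    then have "?r y = 0" if "y \<in> ?X" using cip_self_eq_0[OF finite_Xset, of d ?r y] that by simp
    moreover have "?r y = 0" if "y \<notin> ?X" using r that by (auto simp: hwv_def)
    ultimately show ?thesis by (cases "y \<in> ?X") auto
  qed
  \<comment> \<open>Pairing with \<open>v\<close> gives a sum of squared absolute values whose
    identity term is nonzero.\<close>
  have "k \<noteq> 0"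
  proof
    assume "k = 0"
    then have "0 = cip ?X v (xapp d ?Q v)" by (simp add: Qv_eq cip_def)
    also have "\<dots> = (\<Sum>\<sigma>\<in>?S. cip ?X (permv d \<sigma> v) v * cnj (cip ?X (permv d \<sigma> v) v))"
      unfolding Qv cip_sum_right cip_scale_right
      by (intro sum.cong) (auto simp: cip_commute[of ?X v])
    also have "\<dots> = of_real (\<Sum>\<sigma>\<in>?S. (cmod (cip ?X (permv d \<sigma> v) v))\<^sup>2)"
      by (simp add: complex_norm_square del: of_real_power)
    finally have "(\<Sum>\<sigma>\<in>?S. (cmod (cip ?X (permv d \<sigma> v) v))\<^sup>2) = 0"
      by (metis of_real_eq_0_iff)
    then have "cip ?X (permv d id v) v = 0"
      using fin permutes_id by (simp add: sum_nonneg_eq_0_iff)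
    moreover have "cip ?X (permv d id v) v = cip ?X v v"
      unfolding cip_def by (intro sum.cong) (auto simp: permv_def permw_id Xset_length)
    ultimately show False using nz by simp
  qed
  \<comment> \<open>The multiple is \<open>c * k\<close>, while \<open>c * cip ?X v v\<close> is the
    required coefficient; the factor converts one into the other.\<close>
  let ?R = "xscale (cip ?X v v / k) ?Q"
  show ?thesis
  proof (intro bexI[of _ ?R] conjI ballI allI impI ext)
    fix M y assume M: "M \<in> SymMat d"
    obtain c where c: "\<forall>s' t' v'. hwv d s' t' v' \<longrightarrow> cip ?X v' (xapp d M v) = c * cip ?X v' v"
      using SymMat_hwv_scalar[OF M v] by blast
    have "xapp d ?Q (xapp d M v) y = (\<Sum>\<sigma>\<in>?S. c * (cip ?X (permv d \<sigma> v) v * permv d \<sigma> v y))"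
      unfolding xapp_Qmat using c hw\<sigma> by (intro sum.cong) auto
    also have "\<dots> = c * (k * v y)" unfolding Qv_eq[symmetric] Qv by (simp add: sum_distrib_left)
    finally show "xapp d ?R (xapp d M v) y = cip ?X v (xapp d M v) * v y"
      using c v \<open>k \<noteq> 0\<close> by (simp add: xapp_xscale)
  next
    fix s' t' v' M y assume v': "hwv d s' t' v'" "(s', t') \<noteq> (s, t)" and M: "M \<in> SymMat d"
    obtain c where c: "\<forall>s'' t'' v''. hwv d s'' t'' v'' \<longrightarrow> cip ?X v'' (xapp d M v') = c * cip ?X v'' v'"
      using SymMat_hwv_scalar[OF M v'(1)] by blast
    have "cip ?X (permv d \<sigma> v) (xapp d M v') = 0" if "\<sigma> \<in> ?S" for \<sigma>
      using c hw\<sigma>[OF that] hwv_orthogonal[OF hw\<sigma>[OF that] v'(1)] v'(2) by auto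
    then show "xapp d ?R (xapp d M v') y = 0"
      unfolding xapp_xscale xapp_Qmat by simp
  qed (intro SymMat_xscale Qmat_SymMat)
qed

text \<open>\<open>u\<close> is an orthonormal basis of the module generated by \<open>v\<close>,
  and \<open>E\<close> acts on it as matrix units while annihilating the modules of highest weight
  vectors of weight other than \<open>wt\<close>.\<close>

definition unit_system :: "nat \<Rightarrow> nat \<times> nat \<Rightarrow> (nat list \<Rightarrow> complex) \<Rightarrow> nat \<Rightarrow> (nat \<Rightarrow> nat list \<Rightarrow> complex) \<Rightarrow>
    (nat \<Rightarrow> nat \<Rightarrow> xmat) \<Rightarrow> bool" where
  "unit_system d wt v n u E \<longleftrightarrow>
    (\<forall>i<n. \<exists>M\<in>SymMat d. u i = xapp d M v) \<and>
    (\<forall>i<n. \<forall>j<n. cip (Xset d) (u i) (u j) = of_bool (i = j)) \<and>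
    (\<forall>M\<in>SymMat d. \<forall>x. xapp d M v x = (\<Sum>i<n. cip (Xset d) (u i) (xapp d M v) * u i x)) \<and>
    (\<forall>i<n. \<forall>j<n. E i j \<in> SymMat d) \<and>
    (\<forall>i<n. \<forall>j<n. \<forall>M\<in>SymMat d. \<forall>x. xapp d (E i j) (xapp d M v) x = cip (Xset d) (u j) (xapp d M v) * u i x) \<and>
    (\<forall>i<n. \<forall>j<n. \<forall>M\<in>SymMat d. \<forall>x s' t' v'. hwv d s' t' v' \<longrightarrow> (s', t') \<noteq> wt \<longrightarrow> xapp d (E i j) (xapp d M v') x = 0)"

lemma unit_system_exists:
  assumes v: "hwv d s t v" and nz: "cip (Xset d) v v \<noteq> 0"
  shows "\<exists>n u E. unit_system d (s, t) v n u E"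
proof -
  let ?X = "Xset d" and ?W = "(\<lambda>M. xapp d M v) ` SymMat d"
  obtain Q where Q: "Q \<in> SymMat d"
    "\<And>M. M \<in> SymMat d \<Longrightarrow> xapp d Q (xapp d M v) = (\<lambda>y. cip (Xset d) v (xapp d M v) * v y)"
    "\<And>s' t' v' M. hwv d s' t' v' \<Longrightarrow> (s', t') \<noteq> (s, t) \<Longrightarrow> M \<in> SymMat d \<Longrightarrow> xapp d Q (xapp d M v') = (\<lambda>y. 0)"
    using hw_projector[OF assms] by blast
  have "\<exists>(n::nat) u. (\<forall>i<n. u i \<in> ?W) \<and> (\<forall>i<n. \<forall>j<n. cip ?X (u i) (u j) = of_bool (i = j)) \<and>
    (\<forall>w\<in>?W. \<forall>x. w x = (\<Sum>i<n. cip ?X (u i) w * u i x))"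
  proof (rule orthonormal_basis_exists)
    fix w x assume "w \<in> ?W" "x \<notin> ?X"
    then show "w x = 0" using xapp_outside by blast
  next
    fix w w' assume "w \<in> ?W" "w' \<in> ?W"
    then obtain M M' where M: "M \<in> SymMat d" "M' \<in> SymMat d" "w = xapp d M v" "w' = xapp d M' v" by blast
    then have "(\<lambda>x. w x + w' x) = xapp d (xadd M M') v" by (simp add: xapp_xadd)
    then show "(\<lambda>x. w x + w' x) \<in> ?W" using M SymMat_xadd by blast
  next
    fix c w assume "w \<in> ?W"
    then obtain M where M: "M \<in> SymMat d" "w = xapp d M v" by blast
    then have "(\<lambda>x. c * w x) = xapp d (xscale c M) v" by (simp add: xapp_xscale)
    then show "(\<lambda>x. c * w x) \<in> ?W" using M SymMat_xscale by blast
  qed simp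
  then obtain n :: nat and u where u: "\<forall>i<n. u i \<in> ?W"
    "\<forall>i<n. \<forall>j<n. cip ?X (u i) (u j) = of_bool (i = j)"
    "\<forall>w\<in>?W. \<forall>x. w x = (\<Sum>i<n. cip ?X (u i) w * u i x)" by blast
  have "\<forall>i. \<exists>R. i < n \<longrightarrow> R \<in> SymMat d \<and> u i = xapp d R v" using u(1) by blast
  then obtain R where R: "\<And>i. i < n \<Longrightarrow> R i \<in> SymMat d" "\<And>i. i < n \<Longrightarrow> u i = xapp d (R i) v" by metis
  \<comment> \<open>If \<open>R i\<close> sends \<open>v\<close> to \<open>u i\<close>, then
    \<open>R i\<close>, \<open>Q\<close> and the adjoint of \<open>R j\<close> compose to the matrix
    unit: the adjoint turns pairing with \<open>u j\<close> into pairing with \<open>v\<close>,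
    \<open>Q\<close> extracts this scalar times \<open>v\<close>, and \<open>R i\<close> moves
    \<open>v\<close> to \<open>u i\<close>.\<close>
  define A where "A j = (\<lambda>y z. cnj (R j z y))" for j
  define E where "E i j = xmul d (R i) (xmul d Q (A j))" for i j
  have A: "A j \<in> SymMat d" if "j < n" for j unfolding A_def by (intro SymMat_adjoint R that)
  have E: "E i j \<in> SymMat d" if "i < n" "j < n" for i j
    unfolding E_def by (intro SymMat_xmul R A Q that)
  have act: "xapp d (E i j) (xapp d M w) = xapp d (R i) (xapp d Q (xapp d (xmul d (A j) M) w))" for i j M w
    by (simp add: E_def xapp_xmul)
  have E1: "xapp d (E i j) (xapp d M v) x = cip ?X (u j) (xapp d M v) * u i x"
    if ij: "i < n" "j < n" and M: "M \<in> SymMat d" for i j M x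
  proof -
    have AM: "xmul d (A j) M \<in> SymMat d" by (intro SymMat_xmul A ij M)
    have "cip ?X v (xapp d (xmul d (A j) M) v) = cip ?X (u j) (xapp d M v)"
      unfolding xapp_xmul cip_xapp[of d v "A j"] R(2)[OF ij(2)] by (simp add: A_def)
    then show ?thesis unfolding act Q(2)[OF AM] xapp_scale R(2)[OF ij(1)] by simp
  qed
  have E2: "xapp d (E i j) (xapp d M v') x = 0"
    if ij: "i < n" "j < n" and M: "M \<in> SymMat d" and v': "hwv d s' t' v'" "(s', t') \<noteq> (s, t)" for i j M x s' t' v'
  proof -
    have AM: "xmul d (A j) M \<in> SymMat d" by (intro SymMat_xmul A ij M)
    show ?thesis unfolding act Q(3)[OF v' AM] by simp
  qed
  have "unit_system d (s, t) v n u E"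
    unfolding unit_system_def
  proof (intro conjI)
    show "\<forall>i<n. \<exists>M\<in>SymMat d. u i = xapp d M v" using u(1) by blast
    show "\<forall>M\<in>SymMat d. \<forall>x. xapp d M v x = (\<Sum>i<n. cip ?X (u i) (xapp d M v) * u i x)"
      by (intro ballI allI) (rule u(3)[rule_format], blast)
    show "\<forall>i<n. \<forall>j<n. E i j \<in> SymMat d" by (intro allI impI E)
    show "\<forall>i<n. \<forall>j<n. \<forall>M\<in>SymMat d. \<forall>x. xapp d (E i j) (xapp d M v) x = cip ?X (u j) (xapp d M v) * u i x"
      by (intro allI impI ballI E1)
    show "\<forall>i<n. \<forall>j<n. \<forall>M\<in>SymMat d. \<forall>x s' t' v'. hwv d s' t' v' \<longrightarrow> (s', t') \<noteq> (s, t) \<longrightarrow>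
        xapp d (E i j) (xapp d M v') x = 0"
      by (intro allI impI ballI E2)
  qed (rule u(2))
  then show ?thesis by blast
qed

section \<open>The block decomposition\<close>

lemma xapp_matsum: "xapp d (\<lambda>y z. \<Sum>q\<in>I. c q * E q y z) v = (\<lambda>x. \<Sum>q\<in>I. c q * xapp d (E q) v x)"
  unfolding xapp_def
  by (intro ext) (simp add: sum_distrib_left sum_distrib_right mult.assoc, rule sum.swap)

lemma SymMat_sum:
  assumes "\<And>q. q \<in> I \<Longrightarrow> E q \<in> SymMat d"
  shows "(\<lambda>y z. \<Sum>q\<in>I. c q * E q y z) \<in> SymMat d"
proof (rule SymMatI)
  fix y z assume "y \<notin> Xset d \<or> z \<notin> Xset d"
  then have "E q y z = 0" if "q \<in> I" for q using SymMat_outside[OF assms[OF that]] by blast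
  then show "(\<Sum>q\<in>I. c q * E q y z) = 0" by simp
qed (use assms SymMat_permw in \<open>auto intro!: sum.cong\<close>)

text \<open>The orbit matrices span, so the number of orbits bounds the dimension of
  \<open>SymMat d\<close>.\<close>

lemma SymMat_dependence:
  assumes "finite I" "card (pairtypes d) < card I" and E: "\<And>q. q \<in> I \<Longrightarrow> E q \<in> SymMat d"
  shows "\<exists>c. (\<exists>q\<in>I. c q \<noteq> 0) \<and> (\<forall>y z. (\<Sum>q\<in>I. c q * E q y z) = 0)"
proof -
  have "\<forall>q\<in>I. \<exists>e. E q = (\<lambda>y z. \<Sum>m\<in>pairtypes d. e m * omat d m y z)"
    using SymMat_eq_sum_omat[OF E] by blast
  then obtain e where e: "\<forall>q\<in>I. E q = (\<lambda>y z. \<Sum>m\<in>pairtypes d. e q m * omat d m y z)"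
    by (rule bchoice[THEN exE])
  obtain c where c: "\<exists>q\<in>I. c q \<noteq> 0" "\<forall>m\<in>pairtypes d. (\<Sum>q\<in>I. c q * e q m) = 0"
    using linear_dependence[OF finite_pairtypes assms(1,2), of e] by blast
  have "(\<Sum>q\<in>I. c q * E q y z) = 0" for y z
  proof -
    have "(\<Sum>q\<in>I. c q * E q y z) = (\<Sum>q\<in>I. \<Sum>m\<in>pairtypes d. c q * e q m * omat d m y z)"
      using e by (intro sum.cong) (simp_all add: sum_distrib_left mult.assoc)
    also have "\<dots> = (\<Sum>m\<in>pairtypes d. (\<Sum>q\<in>I. c q * e q m) * omat d m y z)"
      by (subst sum.swap) (simp add: sum_distrib_right)
    also have "\<dots> = 0" using c(2) by simp
    finally show ?thesis .
  qed
  then show ?thesis using c(1) by blast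
qed

definition hwvec :: "nat \<Rightarrow> nat \<times> nat \<Rightarrow> nat list \<Rightarrow> complex" where
  "hwvec d p = (case p of (l, m) \<Rightarrow> bten (hwblocks (d - 3 * l - 2 * m) m l))"

text \<open>Every block of length 2 or 3 contributes one letter 1, and every block of length 3 one
  letter 2. The pair determines \<open>(l, m)\<close>, so modules of different blocks have different
  highest weights.\<close>

definition hwweight :: "nat \<times> nat \<Rightarrow> nat \<times> nat" where
  "hwweight p = (case p of (l, m) \<Rightarrow> (m + l, l))"

lemma hwvec_hwv:
  assumes "p \<in> blocks d"
  shows "hwv d (fst (hwweight p)) (snd (hwweight p)) (hwvec d p)" and "cip (Xset d) (hwvec d p) (hwvec d p) \<noteq> 0"
proof -
  obtain l m where p: "p = (l, m)" by (cases p)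
  have le: "2 * m \<le> d - 3 * l" "3 * l \<le> d" using assms p by (auto simp: blocks_def)
  define ns where "ns = hwblocks (d - 3 * l - 2 * m) m l"
  have ns: "set ns \<subseteq> {1,2,3}" by (auto simp: ns_def hwblocks_def)
  have sum: "sum_list ns = d" using le by (simp add: ns_def hwblocks_def sum_list_replicate)
  have len: "length (filter (\<lambda>n. 2 \<le> n) ns) = m + l" "length (filter (\<lambda>n. 3 \<le> n) ns) = l"
    by (simp_all add: ns_def hwblocks_def)
  show hw: "hwv d (fst (hwweight p)) (snd (hwweight p)) (hwvec d p)"
    using hwv_bten[OF ns] unfolding sum len by (simp add: p hwvec_def hwweight_def ns_def)
  define y where "y = concat (map (\<lambda>n. [0..<n]) ns)"
  have "hwvec d p y = 1" using bten_leading[OF ns] by (simp add: p hwvec_def ns_def y_def)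
  moreover from this have "y \<in> Xset d" using hw by (auto simp: hwv_def)
  ultimately show "cip (Xset d) (hwvec d p) (hwvec d p) \<noteq> 0"
    using cip_self_eq_0[OF finite_Xset, of d "hwvec d p" y] by auto
qed

lemma inj_hwweight: "hwweight p = hwweight q \<longleftrightarrow> p = q"
  by (cases p; cases q) (auto simp: hwweight_def)

theorem SymMat_block_decomposition: "\<exists>\<phi>. alg_iso_dsum d (SymMat d) \<phi>"
proof -
  let ?X = "Xset d" and ?B = "blocks d"
  have "\<forall>p\<in>?B. \<exists>q. unit_system d (hwweight p) (hwvec d p) (fst q) (fst (snd q)) (snd (snd q))"
  proof
    fix p assume "p \<in> ?B"
    then obtain n u E where "unit_system d (hwweight p) (hwvec d p) n u E"
      using unit_system_exists[OF hwvec_hwv] by (metis prod.collapse)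
    then show "\<exists>q. unit_system d (hwweight p) (hwvec d p) (fst q) (fst (snd q)) (snd (snd q))"
      by (intro exI[of _ "(n, u, E)"]) simp
  qed
  then obtain sys where sys: "\<forall>p\<in>?B. unit_system d (hwweight p) (hwvec d p) (fst (sys p)) (fst (snd (sys p))) (snd (snd (sys p)))"
    by (rule bchoice[THEN exE])
  define D where "D p = fst (sys p)" for p
  define u where "u p = fst (snd (sys p))" for p
  define E where "E p = snd (snd (sys p))" for p
  have us: "unit_system d (hwweight p) (hwvec d p) (D p) (u p) (E p)" if "p \<in> ?B" for p
    using sys that by (simp add: D_def u_def E_def)
  have u_W: "\<exists>M\<in>SymMat d. u p i = xapp d M (hwvec d p)" if "p \<in> ?B" "i < D p" for p i
    using us[OF that(1)] that(2) unfolding unit_system_def by blast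
  have u_on: "cip ?X (u p i) (u p j) = of_bool (i = j)" if "p \<in> ?B" "i < D p" "j < D p" for p i j
    using us[OF that(1)] that(2,3) unfolding unit_system_def by blast
  have u_span: "xapp d M (hwvec d p) x = (\<Sum>i<D p. cip ?X (u p i) (xapp d M (hwvec d p)) * u p i x)"
    if "p \<in> ?B" "M \<in> SymMat d" for p M x
    using us[OF that(1)] that(2) unfolding unit_system_def by blast
  have E_S: "E p i j \<in> SymMat d" if "p \<in> ?B" "i < D p" "j < D p" for p i j
    using us[OF that(1)] that(2,3) unfolding unit_system_def by blast
  have E_u: "xapp d (E p i j) (u p' k) x = of_bool (p' = p \<and> k = j) * u p i x"
    if p: "p \<in> ?B" "i < D p" "j < D p" and p': "p' \<in> ?B" "k < D p'" for p i j p' k x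
  proof -
    obtain M where M: "M \<in> SymMat d" "u p' k = xapp d M (hwvec d p')" using u_W[OF p'] by blast
    show ?thesis
    proof (cases "p' = p")
      case True
      have "xapp d (E p i j) (xapp d M (hwvec d p)) x = cip ?X (u p j) (xapp d M (hwvec d p)) * u p i x"
        using us[OF p(1)] p(2,3) M(1) unfolding unit_system_def by blast
      then have "xapp d (E p i j) (u p k) x = cip ?X (u p j) (u p k) * u p i x"
        using True M(2) by (simp only:)
      moreover have "cip ?X (u p j) (u p k) = of_bool (j = k)" using u_on[OF p(1,3)] p'(2) True by simp
      ultimately show ?thesis using True by auto
    next
      case False
      then have "(fst (hwweight p'), snd (hwweight p')) \<noteq> hwweight p" by (simp add: inj_hwweight)
      then have "xapp d (E p i j) (xapp d M (hwvec d p')) x = 0"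
        using us[OF p(1)] p(2,3) M(1) hwvec_hwv(1)[OF p'(1)] unfolding unit_system_def by blast
      then show ?thesis using False M by simp
    qed
  qed
  \<comment> \<open>The matrix of \<open>M\<close> on each module with respect to its orthonormal
    basis, padded with zeros as \<open>DSum\<close> demands. The size is \<open>D p\<close> here;
    its equality with \<open>nsize d p\<close> comes later.\<close>
  define \<phi> :: "xmat \<Rightarrow> bmat" where
    "\<phi> M p i j = (if p \<in> ?B \<and> i < D p \<and> j < D p then cip ?X (u p i) (xapp d M (u p j)) else 0)" for M p i j
  have \<phi>_sum: "\<phi> (\<lambda>y z. \<Sum>q\<in>I. c q * F q y z) p i j = (\<Sum>q\<in>I. c q * \<phi> (F q) p i j)"
    for I :: "((nat \<times> nat) \<times> nat \<times> nat) set" and c F p i j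
    by (cases "p \<in> ?B \<and> i < D p \<and> j < D p")
      (auto simp: \<phi>_def xapp_matsum cip_sum_right cip_scale_right intro!: sum.neutral[symmetric])
  define K where "K = Sigma ?B (\<lambda>p. {..<D p} \<times> {..<D p})"
  define U where "U = (\<lambda>(p, i, j). E p i j)"
  have fin_B: "finite ?B"
    by (rule finite_subset[of _ "{..d} \<times> {..d}"]) (auto simp: blocks_def)
  have fin_K: "finite K" unfolding K_def using fin_B by (intro finite_SigmaI) auto
  have card_K: "card K = (\<Sum>p\<in>?B. (D p)\<^sup>2)"
    unfolding K_def using fin_B by (simp add: card_SigmaI card_cartesian_product power2_eq_square)
  have U_S: "U q \<in> SymMat d" if "q \<in> K" for q using that E_S by (auto simp: K_def U_def)
  have \<phi>_U: "\<phi> (U q) p i j = of_bool ((p, i, j) = q)" if q: "q \<in> K" and k: "(p, i, j) \<in> K" for q p i j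
  proof -
    obtain p' i' j' where q': "q = (p', i', j')" by (cases q) auto
    have p': "p' \<in> ?B" "i' < D p'" "j' < D p'" using q q' by (auto simp: K_def)
    have p: "p \<in> ?B" "i < D p" "j < D p" using k by (auto simp: K_def)
    have "\<phi> (U q) p i j = of_bool (p = p' \<and> j = j') * cip ?X (u p i) (u p' i')"
      using p by (simp add: \<phi>_def U_def q' E_u[OF p' p(1,3), abs_def] cip_scale_right)
    then show ?thesis using u_on[OF p(1,2)] p' q' by auto
  qed
  have \<phi>_comb: "\<phi> (\<lambda>y z. \<Sum>q\<in>K. c q * U q y z) p i j = c (p, i, j)" if "(p, i, j) \<in> K" for c p i j
  proof -
    have "\<phi> (\<lambda>y z. \<Sum>q\<in>K. c q * U q y z) p i j = (\<Sum>q\<in>K. if (p, i, j) = q then c q else 0)"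
      unfolding \<phi>_sum using that by (intro sum.cong) (auto simp: \<phi>_U)
    then show ?thesis using fin_K that by simp
  qed
  have \<phi>_0: "\<phi> (\<lambda>y z. 0) = (\<lambda>p i j. 0)" by (intro ext) (simp add: \<phi>_def xapp_def cip_def)
  have n_le_D: "nsize d p \<le> D p" if "p \<in> ?B" for p
  proof -
    obtain l m where p: "p = (l, m)" by (cases p)
    have "2 * m \<le> d - 3 * l" "3 * l \<le> d" using that p by (auto simp: blocks_def)
    then have "d = (d - 3 * l - 2 * m) + 2 * m + 3 * l" by simp
    then have "card (Idx (d - 3 * l - 2 * m) m) \<le> D p"
    proof (rule hw_module_dim_ge[where l = l and u = "u p"])
      fix M assume "M \<in> SymMat d"
      then show "\<exists>e. \<forall>x. xapp d M (bten (hwblocks (d - 3 * l - 2 * m) m l)) x = (\<Sum>i<D p. e i * u p i x)"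
        using u_span[OF that] by (intro exI allI) (simp only: hwvec_def p prod.case)
    qed
    then show ?thesis using nsize_eq_card_Idx that p by simp
  qed
  \<comment> \<open>\<open>\<phi>\<close> recovers the coefficients of any combination of the
    \<open>U q\<close>, so they are independent and cannot outnumber the orbits.\<close>
  have "card K \<le> card (pairtypes d)"
  proof (rule ccontr)
    assume "\<not> card K \<le> card (pairtypes d)"
    then have "card (pairtypes d) < card K" by simp
    from SymMat_dependence[of K d U, OF fin_K this U_S]
    obtain c where c: "\<exists>q\<in>K. c q \<noteq> 0" "\<forall>y z. (\<Sum>q\<in>K. c q * U q y z) = 0" by blast
    then obtain p i j where k: "(p, i, j) \<in> K" "c (p, i, j) \<noteq> 0" by auto
    have "(\<lambda>y z. \<Sum>q\<in>K. c q * U q y z) = (\<lambda>y z. 0)" using c(2) by simp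
    then show False using \<phi>_comb[OF k(1), of c] \<phi>_0 k(2) by simp
  qed
  moreover have le: "(\<Sum>p\<in>?B. (nsize d p)\<^sup>2) \<le> (\<Sum>p\<in>?B. (D p)\<^sup>2)"
    using n_le_D by (intro sum_mono power_mono) auto
  \<comment> \<open>The chain closes: the sum of \<open>D p\<close> squared is at most the number of
    orbits, which is at most the sum of \<open>nsize d p\<close> squared, which is at most the sum
    of \<open>D p\<close> squared.\<close>
  ultimately have eq: "(\<Sum>p\<in>?B. (nsize d p)\<^sup>2) = (\<Sum>p\<in>?B. (D p)\<^sup>2)" and card_eq: "card K = card (pairtypes d)"
    using card_K card_pairtypes_le[of d] sum_nsize_squares[of d] by linarith+
  have D_eq: "D p = nsize d p" if "p \<in> ?B" for p
  proof -
    have "(nsize d p)\<^sup>2 = (D p)\<^sup>2"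
      using sum_mono_inv[OF eq _ that fin_B] n_le_D by (simp add: power_mono)
    then show ?thesis by simp
  qed
  have \<phi>_inj0: "M = (\<lambda>y z. 0)" if M: "M \<in> SymMat d" and \<phi>M: "\<phi> M = (\<lambda>p i j. 0)" for M
  proof -
    \<comment> \<open>The index \<open>None\<close> adjoins \<open>M\<close> to the
      \<open>card (pairtypes d)\<close> independent matrices \<open>U q\<close>, which forces a
      dependence. As \<open>\<phi> M\<close> vanishes, the \<open>U q\<close> have zero
      coefficients, so only \<open>M\<close> remains.\<close>
    let ?I = "insert None (Some ` K)"
    define F where "F = case_option M U"
    have "card ?I = Suc (card K)" using fin_K by (simp add: card_image)
    then have "card (pairtypes d) < card ?I" using card_eq by simp
    moreover have "F q \<in> SymMat d" if "q \<in> ?I" for q using that M U_S by (auto simp: F_def)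
    ultimately obtain c where c: "\<exists>q\<in>?I. c q \<noteq> 0" "\<forall>y z. (\<Sum>q\<in>?I. c q * F q y z) = 0"
      using SymMat_dependence[of ?I d F] fin_K by auto
    have split: "(\<Sum>q\<in>?I. c q * F q y z) = c None * M y z + (\<Sum>q\<in>K. c (Some q) * U q y z)" for y z
      using fin_K by (simp add: F_def sum.reindex)
    have c0: "c (Some q) = 0" if "q \<in> K" for q
    proof -
      obtain p i j where q: "q = (p, i, j)" by (cases q) auto
      have "(\<lambda>y z. \<Sum>q\<in>K. c (Some q) * U q y z) = xscale (- c None) M"
        using c(2) unfolding split xscale_def by (intro ext) (simp add: add_eq_0_iff)
      moreover have "\<phi> (xscale (- c None) M) p i j = - c None * \<phi> M p i j"
        unfolding \<phi>_def xapp_xscale cip_scale_right by simp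
      ultimately show ?thesis using \<phi>_comb[of p i j "\<lambda>q. c (Some q)"] that q \<phi>M by simp
    qed
    then have "c None \<noteq> 0" using c(1) by auto
    then show ?thesis using c(2) unfolding split by (intro ext) (simp add: c0)
  qed
  have add: "\<phi> (xadd M N) = badd (\<phi> M) (\<phi> N)" for M N
    by (intro ext) (simp add: \<phi>_def badd_def xapp_xadd cip_add_right)
  have scale: "\<phi> (xscale c M) = bscale c (\<phi> M)" for c M
    by (intro ext) (simp add: \<phi>_def bscale_def xapp_xscale cip_scale_right)
  have mul: "\<phi> (xmul d M N) = bmul d (\<phi> M) (\<phi> N)" if N: "N \<in> SymMat d" for M N
  proof (intro ext)
    fix p i j
    show "\<phi> (xmul d M N) p i j = bmul d (\<phi> M) (\<phi> N) p i j"
    proof (cases "p \<in> ?B \<and> i < D p \<and> j < D p")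
      case True
      then obtain R where R: "R \<in> SymMat d" "u p j = xapp d R (hwvec d p)" using u_W by blast
      \<comment> \<open>As \<open>u p j\<close> comes from \<open>hwvec d p\<close> by
        \<open>R\<close>, its image under \<open>N\<close> comes from it by
        \<open>xmul d N R\<close>; it stays in the module and expands in the basis.\<close>
      have "xapp d N (u p j) x = (\<Sum>k<D p. cip ?X (u p k) (xapp d N (u p j)) * u p k x)" for x
        using u_span[of p "xmul d N R" x] True R SymMat_xmul[OF N R(1)] by (simp add: xapp_xmul)
      then have "xapp d N (u p j) = (\<lambda>x. \<Sum>k<D p. cip ?X (u p k) (xapp d N (u p j)) * u p k x)" by (intro ext)
      then have "xapp d M (xapp d N (u p j)) = (\<lambda>x. \<Sum>k<D p. cip ?X (u p k) (xapp d N (u p j)) * xapp d M (u p k) x)"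
        using xapp_sum[of d M "\<lambda>k x. cip ?X (u p k) (xapp d N (u p j)) * u p k x" "{..<D p}"]
        by (simp only: xapp_scale)
      then have "cip ?X (u p i) (xapp d (xmul d M N) (u p j))
          = (\<Sum>k<D p. cip ?X (u p k) (xapp d N (u p j)) * cip ?X (u p i) (xapp d M (u p k)))"
        by (simp only: xapp_xmul cip_sum_right cip_scale_right)
      then show ?thesis using True D_eq by (auto simp: \<phi>_def bmul_def mult.commute)
    next
      case False
      then show ?thesis by (auto simp: \<phi>_def bmul_def intro!: sum.neutral[symmetric])
    qed
  qed
  have "bij_betw \<phi> (SymMat d) (DSum d)"
    unfolding bij_betw_def
  proof
    show "inj_on \<phi> (SymMat d)"
    proof (rule inj_onI)
      fix M N assume MN: "M \<in> SymMat d" "N \<in> SymMat d" "\<phi> M = \<phi> N"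
      have "\<phi> (xadd M (xscale (- 1) N)) = (\<lambda>p i j. 0)"
        unfolding add scale MN(3) by (simp add: badd_def bscale_def)
      then have "xadd M (xscale (- 1) N) = (\<lambda>y z. 0)"
        using MN by (intro \<phi>_inj0 SymMat_xadd SymMat_xscale)
      then show "M = N" by (simp add: xadd_def xscale_def fun_eq_iff)
    qed
    show "\<phi> ` SymMat d = DSum d"
    proof (intro equalityI subsetI)
      fix f assume "f \<in> \<phi> ` SymMat d"
      then show "f \<in> DSum d" using D_eq by (auto simp: DSum_def \<phi>_def split: if_splits)
    next
      fix f assume f: "f \<in> DSum d"
      let ?M = "\<lambda>y z. \<Sum>q\<in>K. (case q of (p, i, j) \<Rightarrow> f p i j) * U q y z"
      have "\<phi> ?M p i j = f p i j" for p i j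
      proof (cases "(p, i, j) \<in> K")
        case True
        then show ?thesis using \<phi>_comb[OF True, of "\<lambda>(p, i, j). f p i j"] by simp
      next
        case False
        then have "\<not> (p \<in> ?B \<and> i < D p \<and> j < D p)" by (auto simp: K_def)
        moreover from this have "f p i j = 0"
          using f D_eq[of p] unfolding DSum_def mem_Collect_eq by metis
        ultimately show ?thesis by (auto simp: \<phi>_def)
      qed
      then have "f = \<phi> ?M" by (intro ext) simp
      moreover have "?M \<in> SymMat d" by (intro SymMat_sum U_S)
      ultimately show "f \<in> \<phi> ` SymMat d" by blast
    qed
  qed
  then show ?thesis unfolding alg_iso_dsum_def using add scale mul by blast
qed

theorem theorem1p4:
  fixes d :: nat
  assumes "d \<ge> 1"
  shows "Terwilliger d = SymMat d \<and> (\<exists>\<phi>. alg_iso_dsum d (Terwilliger d) \<phi>)"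
  using Terwilliger_eq_SymMat SymMat_block_decomposition by simp

end
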